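(* Let $a,b\ge 0$ be real numbers. Let $f$ be an operator monotone function on $[0,\infty)$ with $f(t)\ge 0$ for all $t\in[0,\infty)$, and let $f^\sharp(t)=\dfrac{t}{f(t)}$ for $t\ge 0$. If both $f$ and $f^\sharp$ are not constant, then the function \[ h(t)=\frac{(t-a)(t-b)}{(f(t)-f(a))(f^\sharp(t)-f^\sharp(b))} \] is operator monotone on $[0,\infty)$.
   Context: A real continuous function $f$ on an interval $I$ is called operator monotone on $I$ if $A\le B$ implies $f(A)\le f(B)$ for all self-adjoint matrices $A,B$ (of any common size) with spectra contained in $I$. Functions given by a formula that is formally undefined ($0/0$) at isolated points of $[0,\infty)$ are understood there by continuous extension: $f^\sharp(0)$ means $\lim_{t\to 0+}t/f(t)$ when $f(0)=0$, and the values of $h$ at $t=a$ and $t=b$ are the corresponding limits. *)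

theory Defs
  imports "HOL-Analysis.Analysis" "Jordan_Normal_Form.Spectral_Radius"
begin

definition hermitian_mat :: "complex mat \<Rightarrow> bool" where
  "hermitian_mat A \<longleftrightarrow> square_mat A \<and> mat_adjoint A = A"

definition unitary_mat :: "nat \<Rightarrow> complex mat \<Rightarrow> bool" where
  "unitary_mat n U \<longleftrightarrow>
     U \<in> carrier_mat n n \<and> mat_adjoint U * U = 1\<^sub>m n \<and> U * mat_adjoint U = 1\<^sub>m n"

definition positive_semidefinite_mat :: "complex mat \<Rightarrow> bool" where
  "positive_semidefinite_mat A \<longleftrightarrow>
     hermitian_mat A \<and> (\<forall>v \<in> carrier_vec (dim_row A). 0 \<le> Re ((A *\<^sub>v v) \<bullet>c v))"

text \<open>The Loewner order; it is used below only for matrices of the same size.\<close>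

definition loewner_le :: "complex mat \<Rightarrow> complex mat \<Rightarrow> bool" where
  "loewner_le A B \<longleftrightarrow> positive_semidefinite_mat (B - A)"

text \<open>The functional calculus: if \<open>A = U D U\<^sup>*\<close> with \<open>U\<close> unitary and \<open>D\<close> real diagonal, then
  \<open>f(A) = U f(D) U\<^sup>*\<close>. For Hermitian \<open>A\<close> such a diagonalization exists by the spectral
  theorem, and the result does not depend on it (see \<open>mat_fun_unique\<close>).\<close>

definition unitary_conj_diag :: "nat \<Rightarrow> complex mat \<Rightarrow> (nat \<Rightarrow> real) \<Rightarrow> complex mat" where
  "unitary_conj_diag n U d = U * mat_diag n (\<lambda>i. complex_of_real (d i)) * mat_adjoint U"

definition mat_fun :: "(real \<Rightarrow> real) \<Rightarrow> complex mat \<Rightarrow> complex mat" where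
  "mat_fun f A = (THE X. \<exists>U d. unitary_mat (dim_row A) U \<and>
      A = unitary_conj_diag (dim_row A) U d \<and>
      X = unitary_conj_diag (dim_row A) U (\<lambda>i. f (d i)))"

lemma mat_adjoint_carrier: "A \<in> carrier_mat n m \<Longrightarrow> mat_adjoint A \<in> carrier_mat m n"
  by (rule carrier_matI) (simp_all add: mat_adjoint_def)

lemma mat_fun_unique:
  assumes U: "unitary_mat n U" and V: "unitary_mat n V"
    and eq: "unitary_conj_diag n U d = unitary_conj_diag n V e"
  shows "unitary_conj_diag n U (\<lambda>i. f (d i)) = unitary_conj_diag n V (\<lambda>i. f (e i))"
proof -
  define D where "D = (\<lambda>d :: nat \<Rightarrow> real. mat_diag n (\<lambda>i. complex_of_real (d i)))"
  have D [simp]: "D d \<in> carrier_mat n n" for d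
    by (simp add: D_def)
  have Uc [simp]: "U \<in> carrier_mat n n" "mat_adjoint U \<in> carrier_mat n n"
    and Vc [simp]: "V \<in> carrier_mat n n" "mat_adjoint V \<in> carrier_mat n n"
    using U V by (auto simp: unitary_mat_def mat_adjoint_carrier)
  note u = U[unfolded unitary_mat_def] and v = V[unfolded unitary_mat_def]
  define W where "W = mat_adjoint V * U"
  have W [simp]: "W \<in> carrier_mat n n"
    unfolding W_def by (rule mult_carrier_mat[of _ _ n]) auto
  have mc [simp]: "A * B \<in> carrier_mat n n"
    if "A \<in> carrier_mat n n" "B \<in> carrier_mat n n" for A B :: "complex mat"
    using that by (rule mult_carrier_mat)
  note assoc = assoc_mult_mat[of _ n n _ n _ n]
  have "W * D d = mat_adjoint V * (U * D d * mat_adjoint U) * U"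
    using u right_mult_one_mat[OF D] by (simp add: W_def assoc)
  also have "\<dots> = mat_adjoint V * (V * D e * mat_adjoint V) * U"
    using eq by (simp add: unitary_conj_diag_def D_def)
  also have "\<dots> = (mat_adjoint V * V) * D e * W"
    by (simp add: W_def assoc)
  also have "\<dots> = D e * W"
    using v left_mult_one_mat[OF D] by simp
  finally have WD: "W * D d = D e * W" .
  have l: "D a * W = Matrix.mat n n (\<lambda>(i,j). complex_of_real (a i) * W $$ (i,j))" for a
    unfolding D_def by (rule mat_diag_mult_left) simp
  have r: "W * D a = Matrix.mat n n (\<lambda>(i,j). W $$ (i,j) * complex_of_real (a j))" for a
    unfolding D_def by (rule mat_diag_mult_right) simp
  have fW: "W * D (\<lambda>i. f (d i)) = D (\<lambda>i. f (e i)) * W"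
  proof (rule eq_matI)
    fix i j assume "i < dim_row (D (\<lambda>i. f (e i)) * W)" "j < dim_col (D (\<lambda>i. f (e i)) * W)"
    hence ij: "i < n" "j < n"
      by (auto simp: l)
    have "(W * D d) $$ (i,j) = (D e * W) $$ (i,j)"
      by (simp only: WD)
    hence "W $$ (i,j) = 0 \<or> d j = e i"
      using ij by (auto simp: l r)
    thus "(W * D (\<lambda>i. f (d i))) $$ (i,j) = (D (\<lambda>i. f (e i)) * W) $$ (i,j)"
      using ij by (auto simp: l r)
  qed (auto simp: l r)
  have VW: "V * W = U"
    using v left_mult_one_mat[OF Uc(1)] by (simp add: W_def assoc[symmetric])
  have WU: "W * mat_adjoint U = mat_adjoint V"
    using u right_mult_one_mat[OF Vc(2)] by (simp add: W_def assoc)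
  have "U * D (\<lambda>i. f (d i)) * mat_adjoint U = V * W * D (\<lambda>i. f (d i)) * mat_adjoint U"
    by (simp only: VW)
  also have "\<dots> = V * (W * D (\<lambda>i. f (d i))) * mat_adjoint U"
    by (simp add: assoc)
  also have "\<dots> = V * D (\<lambda>i. f (e i)) * (W * mat_adjoint U)"
    unfolding fW by (simp add: assoc)
  finally show ?thesis
    by (simp add: WU unitary_conj_diag_def D_def)
qed

lemma mat_fun_eq:
  assumes U: "unitary_mat n U"
  shows "mat_fun f (unitary_conj_diag n U d) = unitary_conj_diag n U (\<lambda>i. f (d i))"
proof -
  have "dim_row (unitary_conj_diag n U d) = n"
    using U by (auto simp: unitary_mat_def unitary_conj_diag_def)
  thus ?thesis
    unfolding mat_fun_def using U
    by (intro the_equality) (metis, metis mat_fun_unique)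
qed

definition operator_monotone_on :: "real set \<Rightarrow> (real \<Rightarrow> real) \<Rightarrow> bool" where
  "operator_monotone_on I f \<longleftrightarrow> continuous_on I f \<and>
     (\<forall>n. \<forall>A \<in> carrier_mat n n. \<forall>B \<in> carrier_mat n n.
        hermitian_mat A \<longrightarrow> hermitian_mat B \<longrightarrow>
        spectrum A \<subseteq> complex_of_real ` I \<longrightarrow> spectrum B \<subseteq> complex_of_real ` I \<longrightarrow>
        loewner_le A B \<longrightarrow> loewner_le (mat_fun f A) (mat_fun f B))"

text \<open>In the next two definitions a formally undefined value is replaced by the limit taken
  within \<open>[0,\<infinity>)\<close>. In both places \<open>at t within {0..}\<close> excludes the point \<open>t\<close> itself.\<close>

definition sharp :: "(real \<Rightarrow> real) \<Rightarrow> real \<Rightarrow> real" where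
  "sharp f t = (if t = 0 \<and> f 0 = 0 then Lim (at 0 within {0..}) (\<lambda>s. s / f s) else t / f t)"

definition h_quotient :: "(real \<Rightarrow> real) \<Rightarrow> real \<Rightarrow> real \<Rightarrow> real \<Rightarrow> real" where
  "h_quotient f a b t =
     ((t - a) * (t - b)) / ((f t - f a) * (sharp f t - sharp f b))"

definition h_fun :: "(real \<Rightarrow> real) \<Rightarrow> real \<Rightarrow> real \<Rightarrow> real \<Rightarrow> real" where
  "h_fun f a b t =
     (if t = a \<or> t = b then Lim (at t within {0..}) (h_quotient f a b) else h_quotient f a b t)"

end

theory Submission
  imports Defs
begin

text \<open>With \<open>f\<^sup># = t / f\<close>, expanding the product in the denominator gives
  \<open>- 1 / h = f\<^sup>#(b) f[t,a,b] + f(a) f\<^sup>#[t,a,b]\<close>, where \<open>F[t,a,b]\<close> is the second divided difference.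
  So it suffices that \<open>t \<mapsto> F[t,a,b]\<close> is operator monotone whenever \<open>F\<close> is, which is obvious for
  \<open>F(t) = - 1 / (t + s)\<close>.

  In place of Loewner's integral representation, its dual is used: a functional \<open>\<Sum>c\<^sub>x F(x)\<close> that
  vanishes on constants and is nonnegative on every \<open>- 1 / (t + s)\<close>, \<open>s > 0\<close>, is nonnegative on every operator
  monotone \<open>F\<close>. Up to sign it is the divided difference of \<open>P(- t) F(t)\<close> for a polynomial \<open>P\<close> nonnegative
  on \<open>[0, \<infinity>)\<close>. Such a \<open>P\<close> is a sum of terms \<open>q\<^sup>2\<close> and \<open>s r\<^sup>2\<close>, and for squares the sign of the
  divided difference follows from operator monotonicity for one explicit rank-one perturbation.\<close>

text \<open>Since \<open>f g = t\<close>, the product \<open>(f - f(a)) (g - g(b))\<close> is an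
  affine combination of \<open>f\<close>, \<open>g\<close> and \<open>t\<close> that vanishes at
  \<open>a\<close> and \<open>b\<close>. Divided by \<open>(t - a) (t - b)\<close> it is its own
  divided difference over \<open>t, a, b\<close>, in which the affine part drops out and the weights
  of \<open>f\<close> and \<open>g\<close> are nonnegative up to a common sign. \<open>P\<close> is,
  up to sign, the numerator of \<open>\<Sum>c_x / (x + s)\<close>. Vanishing on constants lowers its
  degree to at most \<open>n - 2\<close> for \<open>n\<close> nodes, which is what the
  divided-difference inequalities allow; partial fractions recover \<open>c_x\<close> from
  \<open>P(- x)\<close>. The obstacle is the exceptional set \<open>0, a, b\<close>, at which
  intermediate functions need not be defined. So operator monotonicity is formulated for arbitrary
  sets of eigenvalues and without continuity, and these points are reached by small shifts. That
  \<open>h\<close> has a two-sided limit at \<open>a\<close> and \<open>b\<close> does not follow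
  from scalar monotonicity; it needs an inequality between several values that only larger matrices
  give.\<close>

section \<open>Diagonalization of Hermitian matrices\<close>

lemma mat_adjoint_index:
  assumes "A \<in> carrier_mat n m" "i < m" "j < n"
  shows "mat_adjoint A $$ (i,j) = cnj (A $$ (j,i))"
  using assms by (auto simp: mat_adjoint_def mat_of_rows_index)

lemma mult_mat_index:
  assumes "A \<in> carrier_mat n m" "B \<in> carrier_mat m k" "i < n" "j < k"
  shows "(A * B) $$ (i,j) = (\<Sum>l<m. A $$ (i,l) * B $$ (l,j))"
  using assms by (simp add: scalar_prod_def lessThan_atLeast0)

lemma mat_adjoint_mult:
  fixes A :: "complex mat"
  assumes "A \<in> carrier_mat n m" "B \<in> carrier_mat m k"
  shows "mat_adjoint (A * B) = mat_adjoint B * mat_adjoint A"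
proof (rule eq_matI)
  note [simp] = mat_adjoint_carrier[OF assms(1)] mat_adjoint_carrier[OF assms(2)]
  have c: "mat_adjoint (A * B) \<in> carrier_mat k n"
    using assms by (intro mat_adjoint_carrier) auto
  have c': "mat_adjoint B * mat_adjoint A \<in> carrier_mat k n"
    by (rule mult_carrier_mat[of _ k m _ n]) auto
  show "dim_row (mat_adjoint (A * B)) = dim_row (mat_adjoint B * mat_adjoint A)"
       "dim_col (mat_adjoint (A * B)) = dim_col (mat_adjoint B * mat_adjoint A)"
    using c c' by auto
  fix i j assume "i < dim_row (mat_adjoint B * mat_adjoint A)" "j < dim_col (mat_adjoint B * mat_adjoint A)"
  then have ij: "i < k" "j < n" using c' by auto
  have "mat_adjoint (A * B) $$ (i,j) = cnj ((A * B) $$ (j,i))"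
    using assms ij by (intro mat_adjoint_index) auto
  also have "\<dots> = (\<Sum>l<m. cnj (A $$ (j,l)) * cnj (B $$ (l,i)))"
    by (simp add: mult_mat_index[OF assms ij(2,1)])
  also have "\<dots> = (\<Sum>l<m. mat_adjoint B $$ (i,l) * mat_adjoint A $$ (l,j))"
    using ij assms by (intro sum.cong) (auto simp: mat_adjoint_index)
  also have "\<dots> = (mat_adjoint B * mat_adjoint A) $$ (i,j)"
    using ij by (subst mult_mat_index[of _ k m _ n]) auto
  finally show "mat_adjoint (A * B) $$ (i,j) = (mat_adjoint B * mat_adjoint A) $$ (i,j)" .
qed

lemma mat_adjoint_adjoint:
  fixes A :: "complex mat"
  shows "mat_adjoint (mat_adjoint A) = A"
proof (rule eq_matI)
  have A: "A \<in> carrier_mat (dim_row A) (dim_col A)" by simp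
  note A' = mat_adjoint_carrier[OF A] note A'' = mat_adjoint_carrier[OF A']
  show "dim_row (mat_adjoint (mat_adjoint A)) = dim_row A" "dim_col (mat_adjoint (mat_adjoint A)) = dim_col A"
    using A'' by auto
  fix i j assume "i < dim_row A" "j < dim_col A"
  then show "mat_adjoint (mat_adjoint A) $$ (i,j) = A $$ (i,j)"
    by (simp add: mat_adjoint_index[OF A] mat_adjoint_index[OF A'])
qed

lemma unitary_mat_iff:
  \<comment> \<open>A one-sided inverse of a square matrix is two-sided, so orthonormal columns are
    enough.\<close>
  "unitary_mat n U \<longleftrightarrow> U \<in> carrier_mat n n \<and>
     (\<forall>i<n. \<forall>k<n. (\<Sum>j<n. cnj (U $$ (j,i)) * U $$ (j,k)) = (if i = k then 1 else 0))"
  (is "_ \<longleftrightarrow> _ \<and> ?O")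
proof (cases "U \<in> carrier_mat n n")
  case True
  note a = mat_adjoint_carrier[OF True]
  have e: "(mat_adjoint U * U) $$ (i,k) = (\<Sum>j<n. cnj (U $$ (j,i)) * U $$ (j,k))"
    if "i < n" "k < n" for i k
    using that True by (auto simp: mult_mat_index[OF a True] mat_adjoint_index intro!: sum.cong)
  have "mat_adjoint U * U = 1\<^sub>m n \<longleftrightarrow> ?O"
  proof
    assume "?O"
    then show "mat_adjoint U * U = 1\<^sub>m n"
      using a True by (intro eq_matI) (auto simp: e simp del: index_mult_mat(1))
  next
    assume h: "mat_adjoint U * U = 1\<^sub>m n"
    show ?O
      by (auto simp: e[symmetric] h)
  qed
  with True show ?thesis
    unfolding unitary_mat_def using mat_mult_left_right_inverse[OF a True] by auto
qed (auto simp: unitary_mat_def)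

lemma unitary_mat_mult:
  assumes "unitary_mat n U" "unitary_mat n V"
  shows "unitary_mat n (U * V)"
proof -
  note u = assms[unfolded unitary_mat_def]
  note [simp] = mat_adjoint_carrier[of U n n] mat_adjoint_carrier[of V n n]
  have UV: "mat_adjoint U * (U * V) = V"
    using u by (subst assoc_mult_mat[of _ n n _ n _ n, symmetric]) auto
  have "mat_adjoint (U * V) * (U * V) = mat_adjoint V * (mat_adjoint U * (U * V))"
    using u by (simp add: mat_adjoint_mult[of U n n V n] assoc_mult_mat[of _ n n _ n _ n] mult_carrier_mat[of _ n n _ n])
  also have "\<dots> = 1\<^sub>m n" using u by (simp add: UV)
  finally have 1: "mat_adjoint (U * V) * (U * V) = 1\<^sub>m n" .
  have c: "U * V \<in> carrier_mat n n" using u by auto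
  show ?thesis unfolding unitary_mat_def
    using 1 c mat_mult_left_right_inverse[OF mat_adjoint_carrier[OF c] c 1] by auto
qed

lemma unitary_conj_diag_carrier:
  "unitary_mat n U \<Longrightarrow> unitary_conj_diag n U d \<in> carrier_mat n n"
  unfolding unitary_conj_diag_def unitary_mat_def
  using mat_adjoint_carrier[of U n n] by (auto intro!: mult_carrier_mat)

lemma unitary_conj_diag_index:
  assumes "U \<in> carrier_mat n n" "i < n" "k < n"
  shows "unitary_conj_diag n U d $$ (i,k) = (\<Sum>j<n. U $$ (i,j) * of_real (d j) * cnj (U $$ (k,j)))"
proof -
  have "U * mat_diag n (\<lambda>i. complex_of_real (d i)) \<in> carrier_mat n n"
    using assms by auto
  then show ?thesis
    unfolding unitary_conj_diag_def
    using assms by (subst mult_mat_index[OF _ mat_adjoint_carrier[OF assms(1)]])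
      (auto simp: mat_diag_mult_right[OF assms(1)] mat_adjoint_index intro!: sum.cong)
qed

lemma hermitian_unitary_conj_diag:
  assumes "unitary_mat n U"
  shows "hermitian_mat (unitary_conj_diag n U d)"
proof -
  have U: "U \<in> carrier_mat n n" using assms by (simp add: unitary_mat_def)
  note c = unitary_conj_diag_carrier[OF assms, of d]
  have "mat_adjoint (unitary_conj_diag n U d) = unitary_conj_diag n U d"
    using c mat_adjoint_carrier[OF c] U
    by (intro eq_matI)
      (auto simp: mat_adjoint_index[OF c] unitary_conj_diag_index ac_simps intro!: sum.cong)
  then show ?thesis using c by (auto simp: hermitian_mat_def)
qed

lemma unitary_conj_diag_unitary_conj_diag:
  assumes "unitary_mat n W" "unitary_mat n V"
  shows "W * unitary_conj_diag n V d * mat_adjoint W = unitary_conj_diag n (W * V) d"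
  unfolding unitary_conj_diag_def
  using assms mat_adjoint_carrier[of W n n] mat_adjoint_carrier[of V n n]
  by (simp add: unitary_mat_def mat_adjoint_mult[of W n n V n] 
      assoc_mult_mat[of _ n n _ n _ n] mult_carrier_mat[of _ n n _ n])

text \<open>Gram-Schmidt, applied to a basis beginning with \<open>v\<close>, keeps \<open>v\<close>
  as its first vector but yields only an orthogonal basis, so each vector is then divided by its
  norm.\<close>

lemma unitary_completion:
  assumes v: "v \<in> carrier_vec n" "v \<noteq> 0\<^sub>v n"
  obtains W c where "unitary_mat n W" "col W 0 = c \<cdot>\<^sub>v v" "0 < n" 
proof -
  interpret cof_vec_space n "TYPE(complex)" .
  have n: "0 < n"
    using v by (metis carrier_vecD eq_vecI gr0I index_zero_vec(2) less_nat_zero_code)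
  let ?b = "basis_completion v"
  note b = basis_completion[OF v]
  define ws where "ws = gram_schmidt n ?b"
  note g = gram_schmidt_result[OF b(2,4,5) ws_def]
  have len: "length ws = n" using g(4) b(6) by simp
  have "?b = v # tl ?b" using b(6,7) n by (cases ?b) auto
  then have hd: "hd ws = v" unfolding ws_def using gram_schmidt_hd[OF v(1)] by metis
  define c where "c w = 1 / complex_of_real (sqrt (Re (w \<bullet>c w)))" for w :: "complex vec"
  define us where "us = map (\<lambda>w. c w \<cdot>\<^sub>v w) ws"
  define W where "W = mat_of_cols n us"
  have W: "W \<in> carrier_mat n n" by (intro carrier_matI) (simp_all add: W_def us_def len)
  have wi: "ws ! i \<in> carrier_vec n" if "i < n" for i using g(3) len that by auto
  have col: "col W i = c (ws ! i) \<cdot>\<^sub>v ws ! i" if "i < n" for i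
    using that len wi[OF that] by (simp add: W_def us_def)
  have "(\<Sum>j<n. cnj (W $$ (j,i)) * W $$ (j,k)) = (if i = k then 1 else 0)" if ik: "i < n" "k < n" for i k
  proof -
    have "(\<Sum>j<n. cnj (W $$ (j,i)) * W $$ (j,k)) = (\<Sum>j<n. col W k $ j * cnj (col W i $ j))"
      using ik W by (intro sum.cong) auto
    also have "\<dots> = c (ws!k) * cnj (c (ws!i)) * (ws!k \<bullet>c ws!i)"
      using carrier_vecD[OF wi[OF ik(1)]] carrier_vecD[OF wi[OF ik(2)]] ik
      by (auto simp: col scalar_prod_def lessThan_atLeast0 sum_distrib_left intro!: sum.cong)
    also have "\<dots> = (if i = k then 1 else 0)"
    proof (cases "i = k")
      case False
      then show ?thesis using corthogonalD[OF g(2), of k i] ik len by simp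
    next
      case True
      define z where "z = ws!k \<bullet>c ws!k"
      have z0: "z \<noteq> 0" using corthogonalD[OF g(2), of k k] ik len by (simp add: z_def)
      have zr: "z = of_real (\<Sum>j<n. (cmod (ws!k $ j))\<^sup>2)"
        using wi[OF ik(2)] ik unfolding z_def
        by (simp add: scalar_prod_def lessThan_atLeast0 complex_norm_square del: of_real_power) 
      define r where "r = (\<Sum>j<n. (cmod (ws!k $ j))\<^sup>2)"
      have r: "r \<ge> 0" by (simp add: r_def sum_nonneg)
      have "z = of_real r" using zr by (simp only: r_def)
      then have "r \<noteq> 0" using z0 by auto
      have "c (ws!k) * cnj (c (ws!k)) * z = of_real (1 / sqrt r * (1 / sqrt r) * r)"
        unfolding c_def z_def[symmetric] \<open>z = of_real r\<close> by (simp only: Re_complex_of_real complex_cnj_divide complex_cnj_one complex_cnj_complex_of_real of_real_mult of_real_divide of_real_1)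
      also have "1 / sqrt r * (1 / sqrt r) * r = 1"
        using r \<open>r \<noteq> 0\<close> by (simp add: power2_eq_square[symmetric] field_simps)
      finally show ?thesis using True by (simp add: z_def)
    qed
    finally show ?thesis .
  qed
  then have "unitary_mat n W" using W by (simp add: unitary_mat_iff)
  moreover have "col W 0 = c v \<cdot>\<^sub>v v"
    using col[OF n] hd len n by (metis hd_conv_nth length_greater_0_conv)
  ultimately show ?thesis using that n by blast
qed

text \<open>Deflation: in an orthonormal basis whose first vector is an eigenvector, the first
  column of the matrix is \<open>e\<close> times the first unit vector. Hermitian symmetry clears
  the first row as well and leaves a smaller Hermitian block.\<close>

theorem hermitian_diagonalization:
  assumes "A \<in> carrier_mat n n" "hermitian_mat A"
  shows "\<exists>U d. unitary_mat n U \<and> A = unitary_conj_diag n U d"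
  using assms
proof (induction n arbitrary: A)
  case 0
  then have "A = unitary_conj_diag 0 (1\<^sub>m 0) (\<lambda>_. 0)" 
    using mat_adjoint_carrier[of "1\<^sub>m 0 :: complex mat" 0 0]
    by (intro eq_matI) (auto simp: unitary_conj_diag_def)
  moreover have "unitary_mat 0 (1\<^sub>m 0)" by (simp add: unitary_mat_iff)
  ultimately show ?case by blast
next
  case (Suc m)
  let ?n = "Suc m"
  note A = Suc.prems(1)
  obtain e where "e \<in> spectrum A" using spectrum_non_empty[OF A] by auto
  then obtain v where v: "v \<in> carrier_vec ?n" "v \<noteq> 0\<^sub>v ?n" "A *\<^sub>v v = e \<cdot>\<^sub>v v"
    using A by (auto simp: spectrum_def eigenvalue_def eigenvector_def)
  obtain W c where W: "unitary_mat ?n W" "col W 0 = c \<cdot>\<^sub>v v"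
    using unitary_completion[OF v(1,2)] by metis
  have Wc: "W \<in> carrier_mat ?n ?n" using W by (simp add: unitary_mat_def)
  note Wa = mat_adjoint_carrier[OF Wc]
  note w = W(1)[unfolded unitary_mat_def]
  note assoc = assoc_mult_mat[of _ ?n ?n _ ?n _ ?n]
  define A' where "A' = mat_adjoint W * A * W"
  have A': "A' \<in> carrier_mat ?n ?n" using A Wc Wa by (auto simp: A'_def)
  have "mat_adjoint A' = A'"
    using A Wc Wa Suc.prems(2) unfolding A'_def hermitian_mat_def
    by (simp add: mat_adjoint_mult[of _ ?n ?n _ ?n] mat_adjoint_adjoint assoc mult_carrier_mat[of _ ?n ?n _ ?n])
  then have sym: "A' $$ (i,j) = cnj (A' $$ (j,i))" if "i < ?n" "j < ?n" for i j
    using mat_adjoint_index[OF A', of i j] that by simp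
  have AW: "A * W = W * A'"
  proof -
    have "W * A' = (W * mat_adjoint W) * A * W"
      using A Wc Wa by (simp add: A'_def assoc mult_carrier_mat[of _ ?n ?n _ ?n])
    then show ?thesis using w A by simp
  qed
  have colA': "A' $$ (i,0) = (if i = 0 then e else 0)" if i: "i < ?n" for i
  proof -
    have AWc: "col (A * W) 0 = e \<cdot>\<^sub>v col W 0"
      using A Wc v W(2) by (subst col_mult2[of _ ?n ?n _ ?n]) 
        (auto simp: mult_mat_vec[OF A] smult_smult_assoc ac_simps)
    have "A' $$ (i,0) = (\<Sum>l<?n. mat_adjoint W $$ (i,l) * (A * W) $$ (l,0))"
      using A Wc Wa i unfolding A'_def 
      by (subst assoc) (auto simp del: index_mult_mat sum.lessThan_Suc intro!: mult_mat_index[of _ ?n ?n _ ?n])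
    also have "\<dots> = (\<Sum>l<?n. cnj (W $$ (l,i)) * (e * W $$ (l,0)))"
    proof (intro sum.cong refl)
      fix l assume l: "l \<in> {..<?n}"
      have "(A * W) $$ (l,0) = col (A * W) 0 $ l" using A Wc l by auto
      also have "\<dots> = e * W $$ (l,0)" unfolding AWc using Wc l by auto
      finally show "mat_adjoint W $$ (i,l) * (A * W) $$ (l,0) = cnj (W $$ (l,i)) * (e * W $$ (l,0))"
        using mat_adjoint_index[OF Wc i, of l] l by simp
    qed
    also have "\<dots> = e * (\<Sum>l<?n. cnj (W $$ (l,i)) * W $$ (l,0))"
      unfolding sum_distrib_left by (intro sum.cong refl) (metis mult.left_commute)
    also have "\<dots> = (if i = 0 then e else 0)"
      using W(1) i unfolding unitary_mat_iff by (auto split: if_splits)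
    finally show ?thesis .
  qed
  \<comment> \<open>Diagonal entries of the Hermitian \<open>A'\<close> are real, hence so is the
    eigenvalue.\<close>
  have e: "complex_of_real (Re e) = e"
    using sym[of 0 0] colA'[of 0] by (simp add: complex_eq_iff)
  have rowA': "A' $$ (0,i) = (if i = 0 then e else 0)" if i: "i < ?n" for i
    using sym[of 0 i] colA'[OF i] i colA'[of 0] by auto
  define C where "C = Matrix.mat m m (\<lambda>(i,j). A' $$ (Suc i, Suc j))"
  have C: "C \<in> carrier_mat m m" by (simp add: C_def)
  have "hermitian_mat C"
    unfolding hermitian_mat_def
  proof (intro conjI eq_matI)
    fix i j assume "i < dim_row C" "j < dim_col C"
    then show "mat_adjoint C $$ (i,j) = C $$ (i,j)"
      using sym[of "Suc i" "Suc j"] C by (simp add: mat_adjoint_index[OF C]) (simp add: C_def)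
  qed (use mat_adjoint_carrier[OF C] C in auto)
  from Suc.IH[OF C this] obtain V d where V: "unitary_mat m V" "C = unitary_conj_diag m V d" by blast
  have Vc: "V \<in> carrier_mat m m" using V by (simp add: unitary_mat_def)
  \<comment> \<open>The direct sum of the scalar 1 and \<open>V\<close>.\<close>
  define V1 where "V1 = Matrix.mat ?n ?n (\<lambda>(i,j). case i of 0 \<Rightarrow> (if j = 0 then 1 else 0) | Suc i' \<Rightarrow> 
     (case j of 0 \<Rightarrow> 0 | Suc j' \<Rightarrow> V $$ (i',j')))"
  define d1 where "d1 = case_nat (Re e) d"
  have V1: "V1 \<in> carrier_mat ?n ?n" by (simp add: V1_def)
  have u1: "unitary_mat ?n V1"
    unfolding unitary_mat_iff
  proof (intro conjI allI impI V1)
    fix i k assume ik: "i < ?n" "k < ?n"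
    show "(\<Sum>j<?n. cnj (V1 $$ (j, i)) * V1 $$ (j, k)) = (if i = k then 1 else 0)"
      using V(1) ik unfolding unitary_mat_iff sum.lessThan_Suc_shift
      by (cases i; cases k) (auto simp: V1_def)
  qed
  have "A' = unitary_conj_diag ?n V1 d1"
  proof (rule eq_matI)
    fix i k assume "i < dim_row (unitary_conj_diag ?n V1 d1)" "k < dim_col (unitary_conj_diag ?n V1 d1)"
    then have ik: "i < ?n" "k < ?n" using unitary_conj_diag_carrier[OF u1, of d1] by auto
    have C': "A' $$ (Suc i, Suc j) = (\<Sum>l<m. V $$ (i,l) * of_real (d l) * cnj (V $$ (j,l)))" 
      if "i < m" "j < m" for i j
      using that unitary_conj_diag_index[OF Vc that, of d] V(2)[symmetric] by (simp add: C_def)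
    have "A' $$ (i,k) = (\<Sum>j<?n. V1 $$ (i,j) * of_real (d1 j) * cnj (V1 $$ (k,j)))"
    proof (cases i)
      case 0
      then show ?thesis unfolding sum.lessThan_Suc_shift rowA'[OF ik(2)] 0
        using ik(2) e by (cases k) (simp_all add: V1_def d1_def)
    next
      case (Suc i')
      show ?thesis
      proof (cases k)
        case 0
        show ?thesis using ik(1) colA'[OF ik(1)] unfolding sum.lessThan_Suc_shift 0 Suc
          by (simp add: V1_def d1_def)
      next
        case (Suc k')
        show ?thesis using ik C'[of i' k'] unfolding sum.lessThan_Suc_shift Suc \<open>i = Suc i'\<close>
          by (simp add: V1_def d1_def)
      qed
    qed
    then show "A' $$ (i,k) = unitary_conj_diag ?n V1 d1 $$ (i,k)"
      using unitary_conj_diag_index[OF V1 ik] by simp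
  qed (use A' unitary_conj_diag_carrier[OF u1, of d1] in auto)
  moreover have "A = W * A' * mat_adjoint W"
  proof -
    have "A = A * (W * mat_adjoint W)" using w A by simp
    also have "\<dots> = W * A' * mat_adjoint W"
      using A Wc Wa by (simp flip: assoc add: AW)
    finally show ?thesis .
  qed
  ultimately have "A = unitary_conj_diag ?n (W * V1) d1"
    using unitary_conj_diag_unitary_conj_diag[OF W(1) u1] by simp
  then show ?case using unitary_mat_mult[OF W(1) u1] by blast
qed

section \<open>Operator monotonicity in terms of quadratic forms\<close>

definition coord :: "complex mat \<Rightarrow> complex vec \<Rightarrow> nat \<Rightarrow> complex" where
  "coord U w i = (mat_adjoint U *\<^sub>v w) $ i"

text \<open>This is \<open><w, A w>\<close> for \<open>A = unitary_conj_diag n U d\<close>, written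
  in the eigenbasis. Passing from \<open>A\<close> to \<open>F(A)\<close> changes only the weights,
  and the form is linear in them, so matrix inequalities become finite sums over values of
  \<open>F\<close>.\<close>

definition qform :: "nat \<Rightarrow> complex mat \<Rightarrow> (nat \<Rightarrow> real) \<Rightarrow> complex vec \<Rightarrow> real" where
  "qform n U d w = (\<Sum>i<n. d i * (cmod (coord U w i))\<^sup>2)"

text \<open>Any set \<open>S\<close> of eigenvalues is allowed because half-lines with finitely many
  points removed occur later.\<close>

definition opmono :: "real set \<Rightarrow> (real \<Rightarrow> real) \<Rightarrow> bool" where
  "opmono S F \<longleftrightarrow> (\<forall>n U V d e. unitary_mat n U \<longrightarrow> unitary_mat n V \<longrightarrow>
     d ` {..<n} \<subseteq> S \<longrightarrow> e ` {..<n} \<subseteq> S \<longrightarrow>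
     (\<forall>w \<in> carrier_vec n. qform n U d w \<le> qform n V e w) \<longrightarrow>
     (\<forall>w \<in> carrier_vec n. qform n U (\<lambda>i. F (d i)) w \<le> qform n V (\<lambda>i. F (e i)) w))"

lemma coord_eq_sum:
  assumes "U \<in> carrier_mat n n" "w \<in> carrier_vec n" "j < n"
  shows "coord U w j = (\<Sum>k<n. cnj (U $$ (k,j)) * w $ k)"
  using assms mat_adjoint_carrier[OF assms(1)]
  by (auto simp: coord_def scalar_prod_def lessThan_atLeast0 mat_adjoint_index intro!: sum.cong)

lemma Re_unitary_conj_diag:
  assumes U: "unitary_mat n U" and w: "w \<in> carrier_vec n"
  shows "Re ((unitary_conj_diag n U d *\<^sub>v w) \<bullet>c w) = qform n U d w"
proof -
  have Uc: "U \<in> carrier_mat n n" using U by (simp add: unitary_mat_def)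
  note c = unitary_conj_diag_carrier[OF U, of d]
  have "(unitary_conj_diag n U d *\<^sub>v w) \<bullet>c w
      = (\<Sum>i<n. (\<Sum>k<n. unitary_conj_diag n U d $$ (i,k) * w $ k) * cnj (w $ i))"
    using c w by (auto simp: scalar_prod_def lessThan_atLeast0 intro!: sum.cong)
  also have "\<dots> = (\<Sum>i<n. \<Sum>k<n. \<Sum>j<n. of_real (d j) * (cnj (U $$ (k,j)) * w $ k) * (U $$ (i,j) * cnj (w $ i)))"
    by (auto simp: unitary_conj_diag_index[OF Uc] sum_distrib_left sum_distrib_right ac_simps intro!: sum.cong)
  also have "\<dots> = (\<Sum>i<n. \<Sum>j<n. \<Sum>k<n. of_real (d j) * (cnj (U $$ (k,j)) * w $ k) * (U $$ (i,j) * cnj (w $ i)))"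
    by (intro sum.cong refl sum.swap)
  also have "\<dots> = (\<Sum>j<n. \<Sum>i<n. \<Sum>k<n. of_real (d j) * (cnj (U $$ (k,j)) * w $ k) * (U $$ (i,j) * cnj (w $ i)))"
    by (rule sum.swap)
  also have "\<dots> = (\<Sum>j<n. of_real (d j) * (coord U w j * cnj (coord U w j)))"
    by (auto simp: coord_eq_sum[OF Uc w] sum_distrib_left sum_distrib_right ac_simps intro!: sum.cong)
  also have "\<dots> = of_real (qform n U d w)"
    unfolding complex_norm_square[symmetric] qform_def by simp
  finally show ?thesis by simp
qed

text \<open>Parseval: the value does not depend on \<open>U\<close>, which is why adding a constant
  to all eigenvalues preserves the order.\<close>

lemma qform_one:
  assumes U: "unitary_mat n U" and w: "w \<in> carrier_vec n"
  shows "qform n U (\<lambda>_. 1) w = Re (w \<bullet>c w)"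
proof -
  have "mat_diag n (\<lambda>i. complex_of_real 1) = 1\<^sub>m n" by (intro eq_matI) (auto simp: mat_diag_def)
  then have "unitary_conj_diag n U (\<lambda>_. 1) = 1\<^sub>m n"
    using U right_mult_one_mat[of U n n] by (simp add: unitary_conj_diag_def unitary_mat_def)
  then show ?thesis using Re_unitary_conj_diag[OF U w, of "\<lambda>_. 1"] w by simp
qed

lemma loewner_le_iff:
  assumes U: "unitary_mat n U" and V: "unitary_mat n V"
  shows "loewner_le (unitary_conj_diag n U d) (unitary_conj_diag n V e) \<longleftrightarrow>
    (\<forall>w \<in> carrier_vec n. qform n U d w \<le> qform n V e w)"
proof -
  let ?A = "unitary_conj_diag n U d" and ?B = "unitary_conj_diag n V e"
  note A = unitary_conj_diag_carrier[OF U, of d] and B = unitary_conj_diag_carrier[OF V, of e]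
  have BA: "?B - ?A \<in> carrier_mat n n" using A B by auto
  have sym: "M $$ (i,j) = cnj (M $$ (j,i))" if "hermitian_mat M" "M \<in> carrier_mat n n" "i < n" "j < n" for M i j
    using mat_adjoint_index[OF that(2-4)] that(1) by (simp add: hermitian_mat_def)
  have "mat_adjoint (?B - ?A) = ?B - ?A"
  proof (rule eq_matI)
    fix i j assume "i < dim_row (?B - ?A)" "j < dim_col (?B - ?A)"
    then have ij: "i < n" "j < n" using BA by auto
    show "mat_adjoint (?B - ?A) $$ (i,j) = (?B - ?A) $$ (i,j)"
      using mat_adjoint_index[OF BA ij] ij A B
        sym[OF hermitian_unitary_conj_diag[OF U] A ij] sym[OF hermitian_unitary_conj_diag[OF V] B ij]
      by simp
  qed (use BA mat_adjoint_carrier[OF BA] in auto)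
  then have herm: "hermitian_mat (?B - ?A)" using A B by (auto simp: hermitian_mat_def)
  have "Re (((?B - ?A) *\<^sub>v w) \<bullet>c w) = qform n V e w - qform n U d w" if w: "w \<in> carrier_vec n" for w
    using A B w minus_scalar_prod_distrib[of "?B *\<^sub>v w" n "?A *\<^sub>v w" "conjugate w"]
    by (simp add: Re_unitary_conj_diag[OF U w, symmetric] Re_unitary_conj_diag[OF V w, symmetric]
        minus_mult_distrib_mat_vec[OF B A w])
  then show ?thesis using herm BA by (auto simp: loewner_le_def positive_semidefinite_mat_def)
qed

lemma spectrum_unitary_conj_diag:
  assumes U: "unitary_mat n U"
  shows "spectrum (unitary_conj_diag n U d) = complex_of_real ` d ` {..<n}"
proof -
  let ?A = "unitary_conj_diag n U d" and ?D = "mat_diag n (\<lambda>i. complex_of_real (d i))"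
  note A = unitary_conj_diag_carrier[OF U, of d]
  have D: "?D \<in> carrier_mat n n" by simp
  have "similar_mat_wit ?A ?D U (mat_adjoint U)"
    using U A mat_adjoint_carrier[of U n n]
    by (auto simp: similar_mat_wit_def Let_def unitary_mat_def unitary_conj_diag_def)
  then have "char_poly ?A = char_poly ?D"
    by (intro char_poly_similar) (auto simp: similar_mat_def)
  also have "\<dots> = (\<Prod>a\<leftarrow>diag_mat ?D. [:- a, 1:])"
    by (rule char_poly_upper_triangular[OF D]) (auto simp: upper_triangular_def mat_diag_def)
  finally show ?thesis
    unfolding spectrum_root_char_poly[OF A]
    by (auto simp: poly_prod_list prod_list_zero_iff diag_mat_def mat_diag_def o_def)
qed

text \<open>Diagonalization makes quantifying over Hermitian matrices the same as quantifying over
  pairs \<open>U\<close>, \<open>d\<close>, and \<open>mat_fun\<close> disappears.\<close>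

lemma operator_monotone_on_iff_opmono:
  "operator_monotone_on S F \<longleftrightarrow> continuous_on S F \<and> opmono S F"
proof -
  let ?P = "\<lambda>n A B. hermitian_mat A \<longrightarrow> hermitian_mat B \<longrightarrow>
        spectrum A \<subseteq> complex_of_real ` S \<longrightarrow> spectrum B \<subseteq> complex_of_real ` S \<longrightarrow>
        loewner_le A B \<longrightarrow> loewner_le (mat_fun F A) (mat_fun F B)"
  have inj: "complex_of_real ` X \<subseteq> complex_of_real ` Y \<longleftrightarrow> X \<subseteq> Y" for X Y
    by (auto simp: image_subset_iff)
  have P: "?P n (unitary_conj_diag n U d) (unitary_conj_diag n V e) \<longleftrightarrow>
     (d ` {..<n} \<subseteq> S \<longrightarrow> e ` {..<n} \<subseteq> S \<longrightarrow>
     (\<forall>w \<in> carrier_vec n. qform n U d w \<le> qform n V e w) \<longrightarrow>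
     (\<forall>w \<in> carrier_vec n. qform n U (\<lambda>i. F (d i)) w \<le> qform n V (\<lambda>i. F (e i)) w))"
    if "unitary_mat n U" "unitary_mat n V" for n U V d e
    using that
    by (simp only: hermitian_unitary_conj_diag spectrum_unitary_conj_diag loewner_le_iff mat_fun_eq inj simp_thms)
  have "(\<forall>n. \<forall>A \<in> carrier_mat n n. \<forall>B \<in> carrier_mat n n. ?P n A B) \<longleftrightarrow> opmono S F" (is "?L \<longleftrightarrow> _")
  proof
    assume L: ?L
    show "opmono S F"
      unfolding opmono_def
    proof (intro allI, goal_cases)
      case (1 n U V d e)
      show ?case
        using L[rule_format, of "unitary_conj_diag n U d" n "unitary_conj_diag n V e"] P[of n U V d e]
          unitary_conj_diag_carrier[of n U d] unitary_conj_diag_carrier[of n V e] by meson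
    qed
  next
    assume R: "opmono S F"
    show ?L
    proof (intro allI ballI)
      fix n and A B :: "complex mat" assume A: "A \<in> carrier_mat n n" and B: "B \<in> carrier_mat n n"
      show "?P n A B"
      proof (intro impI, goal_cases)
        case 1
        obtain U d V e where U: "unitary_mat n U" "A = unitary_conj_diag n U d"
          and V: "unitary_mat n V" "B = unitary_conj_diag n V e"
          using hermitian_diagonalization[OF A 1(1)] hermitian_diagonalization[OF B 1(2)] by auto
        show ?case
          using 1 P[OF U(1) V(1), of d e] R U V unfolding opmono_def by meson
      qed
    qed
  qed
  then show ?thesis unfolding operator_monotone_on_def by simp
qed

section \<open>Divided differences\<close>

text \<open>Lagrange form of the divided difference of order \<open>card X - 1\<close>. A set of
  nodes keeps them distinct and makes the symmetry in the nodes automatic.\<close>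

definition divdiff :: "(real \<Rightarrow> real) \<Rightarrow> real set \<Rightarrow> real" where
  "divdiff F X = (\<Sum>x\<in>X. F x / (\<Prod>y\<in>X - {x}. x - y))"

lemma divdiff_cong: "(\<And>x. x \<in> X \<Longrightarrow> F x = G x) \<Longrightarrow> divdiff F X = divdiff G X"
  by (simp add: divdiff_def)

lemma divdiff_add: "divdiff (\<lambda>t. F t + G t) X = divdiff F X + divdiff G X"
  by (simp add: divdiff_def add_divide_distrib sum.distrib)

lemma divdiff_cmult: "divdiff (\<lambda>t. c * F t) X = c * divdiff F X"
  by (simp add: divdiff_def sum_distrib_left)

text \<open>The summand at \<open>z\<close> vanishes and \<open>x - z\<close> cancels in all others.
  Later proofs use this to trade a factor of the function for a node.\<close>

lemma divdiff_mult_diff: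
  assumes "finite X" "z \<in> X"
  shows "divdiff (\<lambda>t. (t - z) * G t) X = divdiff G (X - {z})"
proof -
  have "divdiff (\<lambda>t. (t - z) * G t) X
      = (\<Sum>x\<in>X - {z}. (x - z) * G x / (\<Prod>y\<in>X - {x}. x - y))"
    using assms by (simp add: divdiff_def sum.remove)
  also have "\<dots> = divdiff G (X - {z})"
    unfolding divdiff_def
  proof (rule sum.cong[OF refl])
    fix x assume x: "x \<in> X - {z}"
    have "X - {x} = insert z (X - {z} - {x})" using x assms by auto
    then have "(\<Prod>y\<in>X - {x}. x - y) = (x - z) * (\<Prod>y\<in>X - {z} - {x}. x - y)"
      using assms by simp
    then show "(x - z) * G x / (\<Prod>y\<in>X - {x}. x - y) = G x / (\<Prod>y\<in>X - {z} - {x}. x - y)"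
      using x by simp
  qed
  finally show ?thesis .
qed

lemma divdiff_mult_id:
  assumes "finite X" "z \<in> X"
  shows "divdiff (\<lambda>t. t * G t) X = divdiff G (X - {z}) + z * divdiff G X"
proof -
  have "divdiff (\<lambda>t. t * G t) X = divdiff (\<lambda>t. (t - z) * G t + z * G t) X"
    by (simp add: algebra_simps)
  then show ?thesis
    by (simp only: divdiff_add divdiff_cmult divdiff_mult_diff[OF assms])
qed

text \<open>Let \<open>D\<close> be the value. Two nodes \<open>z\<close>, \<open>z'\<close> give
  two expansions of the divided difference of \<open>t * c\<close>, whose lower-order parts agree,
  directly for two nodes and by induction otherwise. Hence \<open>z * D = z' * D\<close>, forcing
  \<open>D = 0\<close>.\<close>

lemma divdiff_const:
  assumes "2 \<le> card X"
  shows "divdiff (\<lambda>_. c) X = 0"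
  using assms
proof (induction "card X" arbitrary: X rule: less_induct)
  case less
  have fin: "finite X" using less.prems by (intro card_ge_0_finite) simp
  obtain z z' where z: "z \<in> X" "z' \<in> X" "z \<noteq> z'"
    using less.prems by (metis card_2_iff' obtain_subset_with_card_n subsetD)
  have *: "divdiff (\<lambda>_. c) (X - {z}) = divdiff (\<lambda>_. c) (X - {z'})"
  proof (cases "card X = 2")
    case True
    then have "X = {z, z'}" using z fin by (metis card_2_iff insert_iff singletonD insert_commute)
    then have "X - {z} = {z'}" "X - {z'} = {z}" using z by auto
    then show ?thesis by (simp add: divdiff_def)
  next
    case False
    then have "divdiff (\<lambda>_. c) (X - {u}) = 0" if "u \<in> X" for u
      using less.hyps[of "X - {u}"] less.prems that fin by (simp add: card_gt_0_iff)
    then show ?thesis using z by simp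
  qed
  have "divdiff (\<lambda>t. t * c) X = divdiff (\<lambda>_. c) (X - {u}) + u * divdiff (\<lambda>_. c) X" if "u \<in> X" for u
    using divdiff_mult_id[OF fin that, of "\<lambda>_. c"] .
  from this[OF z(1)] this[OF z(2)] * have "z * divdiff (\<lambda>_. c) X = z' * divdiff (\<lambda>_. c) X"
    by linarith
  then show ?case using z by simp
qed

text \<open>Horner's scheme: in \<open>a + t p(t)\<close> the constant contributes nothing once
  there are two nodes, and multiplication by \<open>t\<close> passes to one node fewer; the
  remaining term \<open>z * divdiff (poly p) X\<close> vanishes by degree.\<close>

lemma divdiff_poly:
  assumes "finite X" "degree p < card X"
  shows "divdiff (poly p) X = coeff p (card X - 1)"
  using assms
proof (induction p arbitrary: X)
  case 0
  then show ?case by (simp add: divdiff_def)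
next
  case (pCons a p)
  obtain z where z: "z \<in> X" using pCons.prems by fastforce
  have e: "divdiff (poly (pCons a p)) X = divdiff (\<lambda>_. a) X + (divdiff (poly p) (X - {z}) + z * divdiff (poly p) X)"
    using divdiff_add[of "\<lambda>_. a" "\<lambda>t. t * poly p t" X] divdiff_mult_id[OF pCons.prems(1) z, of "poly p"]
    by (simp add: poly_pCons[abs_def])
  show ?case
  proof (cases "card X = 1")
    case True
    then have X: "X = {z}" using z by (metis card_1_singletonE singletonD)
    with pCons.prems have "p = 0" by (auto split: if_splits)
    then show ?thesis using e X by (simp add: divdiff_def)
  next
    case False
    then have 2: "2 \<le> card X" using pCons.prems by linarith
    have c: "card (X - {z}) = card X - 1" using z pCons.prems by simp
    have d: "degree p < card X - 1" using pCons.prems(2) 2 by (cases "p = 0") auto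
    have "divdiff (poly p) (X - {z}) = coeff p (card X - 2)"
      using pCons.IH[of "X - {z}"] pCons.prems(1) d c by (simp add: numeral_2_eq_2)
    moreover have "divdiff (poly p) X = coeff p (card X - 1)"
      using pCons.IH[of X] pCons.prems(1) d by simp
    moreover have "\<dots> = 0" using d by (simp add: coeff_eq_0)
    moreover have "coeff (pCons a p) (card X - 1) = coeff p (card X - 2)"
      by (metis 2 Suc_diff_Suc Suc_1 Suc_le_lessD coeff_pCons_Suc)
    ultimately show ?thesis unfolding e divdiff_const[OF 2] by simp
  qed
qed

lemma divdiff_image:
  assumes "finite I" "inj_on x I"
  shows "divdiff F (x ` I) = (\<Sum>i\<in>I. F (x i) / (\<Prod>k\<in>I - {i}. x i - x k))"
proof -
  have "(\<Prod>y\<in>x ` I - {x i}. x i - y) = (\<Prod>k\<in>I - {i}. x i - x k)" if "i \<in> I" for i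
  proof -
    have "x ` I - {x i} = x ` (I - {i})" using assms that by (auto simp: inj_on_def)
    moreover have "inj_on x (I - {i})" using assms by (auto simp: inj_on_def)
    ultimately show ?thesis by (simp add: prod.reindex)
  qed
  then show ?thesis
    unfolding divdiff_def sum.reindex[OF assms(2)] by (intro sum.cong) auto
qed

section \<open>Rank-one perturbations of a diagonal matrix\<close>

lemma monic_prod_linear:
  fixes x :: "nat \<Rightarrow> real"
  assumes "finite I"
  shows "degree (\<Prod>l\<in>I. [:- x l, 1:]) = card I" "coeff (\<Prod>l\<in>I. [:- x l, 1:]) (card I) = 1"
    "poly (\<Prod>l\<in>I. [:- x l, 1:]) t = (\<Prod>l\<in>I. t - x l)"
proof -
  show d: "degree (\<Prod>l\<in>I. [:- x l, 1:]) = card I"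
    using assms by (subst degree_prod_eq_sum_degree) auto
  have "lead_coeff (\<Prod>l\<in>I. [:- x l, 1:]) = 1" by (simp add: lead_coeff_prod)
  then show "coeff (\<Prod>l\<in>I. [:- x l, 1:]) (card I) = 1" using d by simp
  show "poly (\<Prod>l\<in>I. [:- x l, 1:]) t = (\<Prod>l\<in>I. t - x l)" by (simp add: poly_prod)
qed

lemma unitary_matI_rows:
  assumes U: "U \<in> carrier_mat n n"
    and "\<And>i k. i < n \<Longrightarrow> k < n \<Longrightarrow> (\<Sum>j<n. U $$ (i,j) * cnj (U $$ (k,j))) = (if i = k then 1 else 0)"
  shows "unitary_mat n U"
proof -
  note a = mat_adjoint_carrier[OF U]
  have "unitary_mat n (mat_adjoint U)"
    unfolding unitary_mat_iff
  proof (intro conjI allI impI a)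
    fix i k assume ik: "i < n" "k < n"
    have "(\<Sum>j<n. cnj (mat_adjoint U $$ (j,i)) * mat_adjoint U $$ (j,k)) = (\<Sum>j<n. U $$ (i,j) * cnj (U $$ (k,j)))"
      using ik by (intro sum.cong refl) (simp add: mat_adjoint_index[OF U])
    then show "(\<Sum>j<n. cnj (mat_adjoint U $$ (j,i)) * mat_adjoint U $$ (j,k)) = (if i = k then 1 else 0)"
      using assms(2)[OF ik] by simp
  qed
  then show ?thesis using U by (simp add: unitary_mat_def mat_adjoint_adjoint)
qed

lemma cscalar_mult_mat_vec:
  assumes "A \<in> carrier_mat n n" "w \<in> carrier_vec n"
  shows "(A *\<^sub>v w) \<bullet>c w = (\<Sum>i<n. (\<Sum>k<n. A $$ (i,k) * w $ k) * cnj (w $ i))"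
  using assms by (auto simp: scalar_prod_def lessThan_atLeast0 intro!: sum.cong)


text \<open>With \<open>A = diag \<lambda>\<close>, the rank-one perturbation \<open>B = A + v v\<^sup>T\<close> having spectrum
  \<open>\<mu>\<close> is diagonalized by the Cauchy matrix \<open>U\<close>; evaluating \<open>F(B) - F(A) \<ge> 0\<close> on a suitable vector
  gives a divided difference over \<open>\<lambda> \<union> \<mu>\<close>.\<close>

lemma opmono_divdiff_interlaced:
  fixes lam mu :: "nat \<Rightarrow> real" and m :: nat
  defines "PA \<equiv> \<lambda>t. \<Prod>k<m. t - lam k" and "PB \<equiv> \<lambda>t. \<Prod>k<m. t - mu k"
    and "DA \<equiv> \<lambda>i. \<Prod>k\<in>{..<m} - {i}. lam i - lam k" and "DB \<equiv> \<lambda>i. \<Prod>k\<in>{..<m} - {i}. mu i - mu k"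
  assumes F: "opmono S F" and S: "lam ` {..<m} \<subseteq> S" "mu ` {..<m} \<subseteq> S"
    and inj: "inj_on lam {..<m}" "inj_on mu {..<m}"
    and ne: "\<And>i j. i < m \<Longrightarrow> j < m \<Longrightarrow> mu j \<noteq> lam i"
    and alpha: "\<And>i. i < m \<Longrightarrow> 0 < - PB (lam i) / DA i"
    and beta: "\<And>j. j < m \<Longrightarrow> 0 < PA (mu j) / DB j"
    and N: "degree N < m"
  shows "0 \<le> divdiff (\<lambda>t. (poly N t)\<^sup>2 * F t) (lam ` {..<m} \<union> mu ` {..<m})"
proof -
  \<comment> \<open>For \<open>B = A + v v^T\<close> the quotient \<open>PB / PA\<close> of
    characteristic polynomials is \<open>1 - \<Sum>v_i^2 / (t - lam i)\<close>, so
    \<open>v_i^2\<close> must be the negated residue \<open>al i\<close>. Likewise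
    \<open>be j\<close> is the residue of \<open>PA / PB\<close> at \<open>mu j\<close>, the inverse
    squared norm of the eigenvector with entries \<open>v_i / (mu j - lam i)\<close>.\<close>
  define al where "al i = - PB (lam i) / DA i" for i
  define be where "be j = PA (mu j) / DB j" for j
  note al = alpha[folded al_def] and be = beta[folded be_def]
  have PA_ne: "PA (mu j) \<noteq> 0" if "j < m" for j using ne that by (auto simp: PA_def)
  have PB_ne: "PB (lam i) \<noteq> 0" if "i < m" for i using ne that by (force simp: PB_def)
  have DA_ne: "DA i \<noteq> 0" if "i < m" for i using inj that by (auto simp: DA_def inj_on_def)
  have DB_ne: "DB i \<noteq> 0" if "i < m" for i using inj that by (auto simp: DB_def inj_on_def)
  have PA_split: "PA t = (t - lam i) * (\<Prod>k\<in>{..<m} - {i}. t - lam k)" if "i < m" for i t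
    using that unfolding PA_def by (simp add: prod.remove)
  have PB_split: "PB t = (t - mu i) * (\<Prod>k\<in>{..<m} - {i}. t - mu k)" if "i < m" for i t
    using that unfolding PB_def by (simp add: prod.remove)
  have ddB: "(\<Sum>j<m. poly p (mu j) / DB j) = coeff p (m - 1)" if "degree p < m" for p
    using divdiff_poly[of "mu ` {..<m}" p] divdiff_image[OF _ inj(2), of "poly p"] that inj
    by (simp add: card_image DB_def)
  \<comment> \<open>The next three sums are divided differences of monic products of factors
    \<open>t - lam l\<close>. Degree \<open>m - 1\<close> over the \<open>m\<close> nodes
    \<open>mu\<close> gives 1, degree \<open>m - 2\<close> gives 0, and so does degree
    \<open>m - 1\<close> once \<open>lam i\<close> is added as a node. The first sum yields the
    entries of \<open>B\<close>, the other two the orthonormality of the rows of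
    \<open>U\<close>.\<close>
  have s1: "(\<Sum>j<m. be j / (mu j - lam i)) = 1" if i: "i < m" for i
  proof -
    let ?p = "\<Prod>l\<in>{..<m} - {i}. [:- lam l, 1:]"
    note p = monic_prod_linear[of "{..<m} - {i}" lam]
    have "(\<Sum>j<m. be j / (mu j - lam i)) = (\<Sum>j<m. poly ?p (mu j) / DB j)"
      using i ne by (intro sum.cong) (auto simp: be_def PA_split[OF i] p)
    then show ?thesis using ddB[of ?p] p i by simp
  qed
  have s2: "(\<Sum>j<m. be j / ((mu j - lam i) * (mu j - lam k))) = 0" if ik: "i < m" "k < m" "i \<noteq> k" for i k
  proof -
    let ?p = "\<Prod>l\<in>{..<m} - {i} - {k}. [:- lam l, 1:]"
    note p = monic_prod_linear[of "{..<m} - {i} - {k}" lam]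
    have PA2: "PA t = (t - lam i) * (t - lam k) * (\<Prod>l\<in>{..<m} - {i} - {k}. t - lam l)" for t
      using ik prod.remove[of "{..<m} - {i}" k "\<lambda>l. t - lam l"] by (simp add: PA_split[OF ik(1)])
    have "(\<Sum>j<m. be j / ((mu j - lam i) * (mu j - lam k))) = (\<Sum>j<m. poly ?p (mu j) / DB j)"
      using ik ne by (intro sum.cong) (auto simp: be_def PA2 p)
    moreover have "card ({..<m} - {i} - {k}) = m - 2" using ik by simp
    moreover have "m \<ge> 2" using ik by linarith
    ultimately show ?thesis using ddB[of ?p] p by (simp add: coeff_eq_0)
  qed
  have s3: "(\<Sum>j<m. be j / (mu j - lam i)\<^sup>2) = 1 / al i" if i: "i < m" for i
  proof -
    let ?p = "\<Prod>l\<in>{..<m} - {i}. [:- lam l, 1:]"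
    note p = monic_prod_linear[of "{..<m} - {i}" lam]
    let ?X = "insert (lam i) (mu ` {..<m})"
    have nin: "lam i \<notin> mu ` {..<m}" using ne[OF i] by (metis imageE lessThan_iff)
    have "divdiff (poly ?p) ?X = 0"
      using divdiff_poly[of ?X ?p] p i inj nin by (simp add: card_image coeff_eq_0)
    moreover have "divdiff (poly ?p) ?X = DA i / PB (lam i) + (\<Sum>j<m. be j / (mu j - lam i)\<^sup>2)"
    proof -
      have "poly ?p (mu j) / (\<Prod>y\<in>?X - {mu j}. mu j - y) = be j / (mu j - lam i)\<^sup>2" if j: "j < m" for j
      proof -
        have "?X - {mu j} = insert (lam i) (mu ` ({..<m} - {j}))" using j inj nin by (auto simp: inj_on_def)
        moreover have "lam i \<notin> mu ` ({..<m} - {j})" using nin by auto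
        moreover have "inj_on mu ({..<m} - {j})" using inj by (auto simp: inj_on_def)
        ultimately have "(\<Prod>y\<in>?X - {mu j}. mu j - y) = (mu j - lam i) * DB j"
          by (simp add: prod.reindex DB_def)
        then show ?thesis using ne[OF i j] DB_ne[OF j]
          by (simp add: be_def PA_split[OF i] p power2_eq_square)
      qed
      moreover have "?X - {lam i} = mu ` {..<m}" using nin by auto
      moreover have "(\<Prod>y\<in>mu ` {..<m}. lam i - y) = PB (lam i)"
        using inj by (simp add: prod.reindex PB_def)
      ultimately show ?thesis
        using nin inj unfolding divdiff_def by (simp add: sum.reindex p DA_def)
    qed
    ultimately show ?thesis using PB_ne[OF i] DA_ne[OF i] by (simp add: al_def field_simps)
  qed
  define v where "v i = sqrt (al i)" for i
  define c where "c j = sqrt (be j)" for j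
  have v: "v i > 0" "v i * v i = al i" if "i < m" for i using al[OF that] by (simp_all add: v_def)
  have c: "c j > 0" "c j * c j = be j" if "j < m" for j using be[OF that] by (simp_all add: c_def)
  define u where "u i j = v i * c j / (mu j - lam i)" for i j
  define U where "U = Matrix.mat m m (\<lambda>(i,j). complex_of_real (u i j))"
  have U: "U \<in> carrier_mat m m" by (simp add: U_def)
  have Ui: "U $$ (i,j) = of_real (u i j)" if "i < m" "j < m" for i j using that by (simp add: U_def)
  have uu: "u i j * u k j = v i * v k * (be j / ((mu j - lam i) * (mu j - lam k)))" if "j < m" for i j k
    using c(2)[OF that] by (simp add: u_def mult_ac flip: c(2)[OF that])
  have orth: "(\<Sum>j<m. u i j * u k j) = (if i = k then 1 else 0)" if ik: "i < m" "k < m" for i k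
  proof -
    have "(\<Sum>j<m. u i j * u k j) = v i * v k * (\<Sum>j<m. be j / ((mu j - lam i) * (mu j - lam k)))"
      unfolding sum_distrib_left by (intro sum.cong) (auto simp: uu)
    then show ?thesis
      using s2[OF ik] s3[OF ik(1)] v[OF ik(1)] al[OF ik(1)] by (auto simp: power2_eq_square)
  qed
  have unitU: "unitary_mat m U"
  proof (rule unitary_matI_rows[OF U])
    fix i k assume ik: "i < m" "k < m"
    have "(\<Sum>j<m. U $$ (i,j) * cnj (U $$ (k,j))) = of_real (\<Sum>j<m. u i j * u k j)"
      using ik by (simp add: Ui)
    then show "(\<Sum>j<m. U $$ (i,j) * cnj (U $$ (k,j))) = (if i = k then 1 else 0)"
      by (simp add: orth[OF ik])
  qed
  have one: "1\<^sub>m m \<in> carrier_mat m m" by simp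
  have unit1: "unitary_mat m (1\<^sub>m m)"
    unfolding unitary_mat_iff
  proof (intro conjI allI impI one)
    fix i k assume ik: "i < m" "k < m"
    have "(\<Sum>j<m. cnj (1\<^sub>m m $$ (j,i)) * 1\<^sub>m m $$ (j,k)) = (\<Sum>j<m. if j = i then (if i = k then 1 else 0) else 0)"
      using ik by (intro sum.cong) auto
    then show "(\<Sum>j<m. cnj (1\<^sub>m m $$ (j,i)) * 1\<^sub>m m $$ (j,k)) = (if i = k then 1 else 0)"
      using ik by simp
  qed
  have coord1: "coord (1\<^sub>m m) w i = w $ i" if "w \<in> carrier_vec m" "i < m" for w i
    using that by (subst coord_eq_sum[OF one]) (auto simp: if_distrib[of cnj] if_distrib[of "\<lambda>x. x * _"] cong: if_cong)
  have "qform m (1\<^sub>m m) lam w \<le> qform m U mu w" if w: "w \<in> carrier_vec m" for w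
  proof -
    have Be: "unitary_conj_diag m U mu $$ (i,k) = of_real (v i * v k + (if i = k then lam i else 0))"
      if ik: "i < m" "k < m" for i k
    proof -
      have "unitary_conj_diag m U mu $$ (i,k) = of_real (\<Sum>j<m. u i j * mu j * u k j)"
        using ik by (simp add: unitary_conj_diag_index[OF U] Ui)
      also have "(\<Sum>j<m. u i j * mu j * u k j)
          = (\<Sum>j<m. v i * v k * (be j / (mu j - lam k)) + lam i * (u i j * u k j))"
      proof (rule sum.cong[OF refl])
        fix j assume "j \<in> {..<m}"
        then have j: "j < m" by simp
        \<comment> \<open>Splitting \<open>mu j\<close> as \<open>(mu j - lam i) + lam i\<close>
          cancels one denominator, so that \<open>s1\<close> and \<open>orth\<close> evaluate the
          sum.\<close>
        have "u i j * mu j * u k j = (mu j - lam i) * (u i j * u k j) + lam i * (u i j * u k j)"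
          by (simp add: algebra_simps)
        also have "(mu j - lam i) * (u i j * u k j) = v i * v k * (be j / (mu j - lam k))"
          using ne[OF ik(1) j] by (simp add: uu[OF j])
        finally show "u i j * mu j * u k j = v i * v k * (be j / (mu j - lam k)) + lam i * (u i j * u k j)" .
      qed
      also have "\<dots> = v i * v k + (if i = k then lam i else 0)"
        unfolding sum.distrib sum_distrib_left[symmetric] s1[OF ik(2)] orth[OF ik] by simp
      finally show ?thesis .
    qed
    have "(unitary_conj_diag m U mu *\<^sub>v w) \<bullet>c w
        = (\<Sum>i<m. (\<Sum>k<m. unitary_conj_diag m U mu $$ (i,k) * w $ k) * cnj (w $ i))"
      by (rule cscalar_mult_mat_vec[OF unitary_conj_diag_carrier[OF unitU] w])
    also have "\<dots> = (\<Sum>i<m. (of_real (v i) * (\<Sum>k<m. of_real (v k) * w $ k) + of_real (lam i) * w $ i) * cnj (w $ i))"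
    proof (intro sum.cong refl arg_cong2[where f = "(*)"])
      fix i assume "i \<in> {..<m}"
      then have i: "i < m" by simp
      have "(\<Sum>k<m. unitary_conj_diag m U mu $$ (i,k) * w $ k)
         = (\<Sum>k<m. of_real (v i) * (of_real (v k) * w $ k) + (if k = i then of_real (lam i) * w $ i else 0))"
        using i by (intro sum.cong) (auto simp: Be algebra_simps)
      then show "(\<Sum>k<m. unitary_conj_diag m U mu $$ (i,k) * w $ k)
         = of_real (v i) * (\<Sum>k<m. of_real (v k) * w $ k) + of_real (lam i) * w $ i"
        using i by (simp add: sum.distrib sum_distrib_left)
    qed
    also have "\<dots> = (\<Sum>k<m. of_real (v k) * w $ k) * cnj (\<Sum>k<m. of_real (v k) * w $ k)
        + (\<Sum>i<m. of_real (lam i) * (w $ i * cnj (w $ i)))"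
    proof -
      define z where "z = (\<Sum>k<m. of_real (v k) * w $ k)"
      have "cnj z = (\<Sum>k<m. of_real (v k) * cnj (w $ k))" by (simp add: z_def)
      then show ?thesis
        unfolding z_def[symmetric] sum_distrib_left sum.distrib[symmetric] \<open>cnj z = _\<close>
        by (intro sum.cong refl) (simp only: algebra_simps)
    qed
    also have "\<dots> = of_real ((cmod (\<Sum>k<m. of_real (v k) * w $ k))\<^sup>2 + qform m (1\<^sub>m m) lam w)"
      unfolding complex_norm_square[symmetric] qform_def using coord1[OF w] by simp
    finally have "qform m U mu w = (cmod (\<Sum>k<m. of_real (v k) * w $ k))\<^sup>2 + qform m (1\<^sub>m m) lam w"
      using Re_unitary_conj_diag[OF unitU w, of mu] by simp
    then show ?thesis by simp
  qed
  then have key: "qform m (1\<^sub>m m) (\<lambda>i. F (lam i)) w \<le> qform m U (\<lambda>i. F (mu i)) w" if "w \<in> carrier_vec m" for w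
    using F unit1 unitU S that unfolding opmono_def by blast
  \<comment> \<open>By partial fractions of \<open>N / PA\<close>, valid as
    \<open>degree N < m\<close>, this vector has \<open>U\<close>-coordinates
    \<open>c j * N (mu j) / PA (mu j)\<close>. The scaling by \<open>DA i\<close> and
    \<open>v i\<close> makes the squared coordinates in both bases \<open>N^2\<close> times the
    Lagrange weights over all nodes, with opposite sign on \<open>lam\<close>.\<close>
  define x where "x i = poly N (lam i) / (DA i * v i)" for i
  define w where "w = Matrix.vec m (\<lambda>i. complex_of_real (x i))"
  have w: "w \<in> carrier_vec m" by (simp add: w_def)
  have nsum: "(\<Sum>k<m. poly N (lam k) / (DA k * (mu j - lam k))) = poly N (mu j) / PA (mu j)" if j: "j < m" for j
  proof -
    let ?X = "insert (mu j) (lam ` {..<m})"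
    have nin: "mu j \<notin> lam ` {..<m}" using ne j by auto
    have "poly N (lam k) / (\<Prod>y\<in>?X - {lam k}. lam k - y) = - (poly N (lam k) / (DA k * (mu j - lam k)))"
      if k: "k < m" for k
    proof -
      have "?X - {lam k} = insert (mu j) (lam ` ({..<m} - {k}))" using k inj nin by (auto simp: inj_on_def)
      moreover have "mu j \<notin> lam ` ({..<m} - {k})" using nin by auto
      moreover have "inj_on lam ({..<m} - {k})" using inj by (auto simp: inj_on_def)
      ultimately have "(\<Prod>y\<in>?X - {lam k}. lam k - y) = (lam k - mu j) * DA k"
        by (simp add: prod.reindex DA_def)
      also have "\<dots> = - (DA k * (mu j - lam k))" by (simp add: algebra_simps)
      finally show ?thesis by (simp only: divide_minus_right)
    qed
    moreover have "?X - {mu j} = lam ` {..<m}" using nin by auto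
    moreover have "(\<Prod>y\<in>lam ` {..<m}. mu j - y) = PA (mu j)"
      using inj by (simp add: prod.reindex PA_def)
    ultimately have "divdiff (poly N) ?X = poly N (mu j) / PA (mu j) - (\<Sum>k<m. poly N (lam k) / (DA k * (mu j - lam k)))"
      using nin inj unfolding divdiff_def by (simp add: sum.reindex sum_negf)
    moreover have "divdiff (poly N) ?X = 0"
      using divdiff_poly[of ?X N] N inj nin by (simp add: card_image coeff_eq_0)
    ultimately show ?thesis by simp
  qed
  have coordU: "coord U w j = of_real (c j * poly N (mu j) / PA (mu j))" if j: "j < m" for j
  proof -
    have "coord U w j = of_real (\<Sum>k<m. u k j * x k)"
      unfolding coord_eq_sum[OF U w j] using j by (simp add: Ui w_def)
    also have "(\<Sum>k<m. u k j * x k) = (\<Sum>k<m. c j * (poly N (lam k) / (DA k * (mu j - lam k))))"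
    proof (rule sum.cong[OF refl])
      fix k assume "k \<in> {..<m}"
      then show "u k j * x k = c j * (poly N (lam k) / (DA k * (mu j - lam k)))"
        using v(1)[of k] by (simp add: u_def x_def)
    qed
    also have "\<dots> = c j * poly N (mu j) / PA (mu j)"
      unfolding sum_distrib_left[symmetric] nsum[OF j] by simp
    finally show ?thesis .
  qed
  let ?G = "\<lambda>t. (poly N t)\<^sup>2 * F t"
  have "qform m (1\<^sub>m m) (\<lambda>i. F (lam i)) w = (\<Sum>i<m. - (?G (lam i) / (DA i * PB (lam i))))"
    unfolding qform_def
  proof (rule sum.cong[OF refl])
    fix i assume "i \<in> {..<m}"
    then have i: "i < m" by simp
    have "(x i)\<^sup>2 = (poly N (lam i))\<^sup>2 / ((DA i)\<^sup>2 * al i)"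
      using v(2)[OF i] by (simp add: x_def power2_eq_square mult_ac flip: v(2)[OF i])
    also have "(DA i)\<^sup>2 * al i = - (DA i * PB (lam i))"
      using DA_ne[OF i] by (simp add: al_def power2_eq_square)
    finally show "F (lam i) * (cmod (coord (1\<^sub>m m) w i))\<^sup>2 = - (?G (lam i) / (DA i * PB (lam i)))"
      using coord1[OF w i] i by (simp add: w_def)
  qed
  moreover have "qform m U (\<lambda>i. F (mu i)) w = (\<Sum>j<m. ?G (mu j) / (DB j * PA (mu j)))"
    unfolding qform_def
  proof (rule sum.cong[OF refl])
    fix j assume "j \<in> {..<m}"
    then have j: "j < m" by simp
    have "(c j * poly N (mu j) / PA (mu j))\<^sup>2 = be j * (poly N (mu j))\<^sup>2 / (PA (mu j))\<^sup>2"
      using c(2)[OF j] by (simp add: power2_eq_square mult_ac flip: c(2)[OF j])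
    also have "\<dots> = (poly N (mu j))\<^sup>2 / (DB j * PA (mu j))"
      using PA_ne[OF j] by (simp add: be_def power2_eq_square)
    finally show "F (mu j) * (cmod (coord U w j))\<^sup>2 = ?G (mu j) / (DB j * PA (mu j))"
      unfolding coordU[OF j] norm_of_real power2_abs by simp
  qed
  moreover have "divdiff ?G (lam ` {..<m} \<union> mu ` {..<m})
      = (\<Sum>i<m. ?G (lam i) / (DA i * PB (lam i))) + (\<Sum>j<m. ?G (mu j) / (DB j * PA (mu j)))"
  proof -
    let ?X = "lam ` {..<m} \<union> mu ` {..<m}"
    have disj: "lam ` {..<m} \<inter> mu ` {..<m} = {}" using ne[THEN not_sym] by auto
    have "(\<Prod>y\<in>?X - {lam i}. lam i - y) = DA i * PB (lam i)" if i: "i < m" for i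
    proof -
      have "?X - {lam i} = lam ` ({..<m} - {i}) \<union> mu ` {..<m}" using i inj disj by (auto simp: inj_on_def)
      moreover have "inj_on lam ({..<m} - {i})" using inj by (auto simp: inj_on_def)
      moreover have "lam ` ({..<m} - {i}) \<inter> mu ` {..<m} = {}" using disj by auto
      ultimately show ?thesis using inj by (simp add: prod.union_disjoint prod.reindex DA_def PB_def)
    qed
    moreover have "(\<Prod>y\<in>?X - {mu j}. mu j - y) = DB j * PA (mu j)" if j: "j < m" for j
    proof -
      have "?X - {mu j} = mu ` ({..<m} - {j}) \<union> lam ` {..<m}" using j inj disj by (auto simp: inj_on_def)
      moreover have "inj_on mu ({..<m} - {j})" using inj by (auto simp: inj_on_def)
      moreover have "mu ` ({..<m} - {j}) \<inter> lam ` {..<m} = {}" using disj by auto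
      ultimately show ?thesis using inj by (simp add: prod.union_disjoint prod.reindex DB_def PA_def)
    qed
    ultimately show ?thesis
      using disj inj unfolding divdiff_def by (simp add: sum.union_disjoint sum.reindex)
  qed
  ultimately show ?thesis
    using key[OF w] by (simp add: sum_negf)
qed


text \<open>Assigning the sorted nodes alternately to \<open>lam\<close> and \<open>mu\<close> gives
  \<open>lam 0 < mu 0 < lam 1 < ...\<close>. For \<open>k \<noteq> i\<close> the points
  \<open>lam k\<close> and \<open>mu k\<close> lie on the same side of \<open>lam i\<close> and of
  \<open>mu i\<close>, so each quotient of matching factors in the two sign conditions is
  positive.\<close>

lemma opmono_divdiff_even:
  assumes F: "opmono S F" and X: "finite X" "X \<subseteq> S" "card X = 2 * m" and N: "degree N < m"
  shows "0 \<le> divdiff (\<lambda>t. (poly N t)\<^sup>2 * F t) X"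
proof -
  define xs where "xs = sorted_list_of_set X"
  have set: "set xs = X" and len: "length xs = 2 * m"
    using X by (simp_all add: xs_def)
  have less: "xs ! i < xs ! j" if "i < j" "j < 2 * m" for i j
    using sorted_wrt_nth_less[OF strict_sorted_list_of_set[of X] that(1)] that len by (simp add: xs_def)
  define lam where "lam i = xs ! (2 * i)" for i
  define mu where "mu i = xs ! (2 * i + 1)" for i
  have lm: "lam i < mu k" if "i \<le> k" "k < m" for i k
    using that unfolding lam_def mu_def by (intro less) auto
  have ml: "mu i < lam k" if "i < k" "k < m" for i k
    using that unfolding lam_def mu_def by (intro less) auto
  have ll: "lam i < lam k" if "i < k" "k < m" for i k
    using that unfolding lam_def by (intro less) auto
  have mm: "mu i < mu k" if "i < k" "k < m" for i k
    using that unfolding mu_def by (intro less) auto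
  have Xeq: "X = lam ` {..<m} \<union> mu ` {..<m}"
  proof -
    have "X = (!) xs ` {..<2 * m}" using set len by (metis atLeast_upt list.set_map map_nth)
    also have "{..<2 * m} = (\<lambda>i. 2 * i) ` {..<m} \<union> (\<lambda>i. 2 * i + 1) ` {..<m}"
    proof -
      have "x \<in> (\<lambda>i. 2 * i) ` {..<m} \<union> (\<lambda>i. 2 * i + 1) ` {..<m}" if "x < 2 * m" for x
      proof (cases "even x")
        case True
        then show ?thesis using that by (auto elim!: evenE)
      next
        case False
        then show ?thesis using that by (auto elim!: oddE)
      qed
      then show ?thesis by auto
    qed
    finally show ?thesis by (simp add: image_Un image_image lam_def mu_def)
  qed
  have ne: "mu j \<noteq> lam i" if "i < m" "j < m" for i j
    using lm[of i j] ml[of j i] that by (cases "i \<le> j") auto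
  show ?thesis
    unfolding Xeq
  proof (rule opmono_divdiff_interlaced[OF F _ _ _ _ ne _ _ N])
    show "inj_on lam {..<m}" by (rule linorder_inj_onI) (use ll in \<open>auto dest: less_imp_neq\<close>)
    show "inj_on mu {..<m}" by (rule linorder_inj_onI) (use mm in \<open>auto dest: less_imp_neq\<close>)
    show "lam ` {..<m} \<subseteq> S" "mu ` {..<m} \<subseteq> S" using X(2) Xeq by auto
    fix i assume i: "i < m"
    have "- (\<Prod>k<m. lam i - mu k) / (\<Prod>k\<in>{..<m} - {i}. lam i - lam k)
        = (mu i - lam i) * (\<Prod>k\<in>{..<m} - {i}. (lam i - mu k) / (lam i - lam k))"
      using i by (simp add: prod.remove[of "{..<m}" i] prod_dividef)
        (metis minus_diff_eq minus_divide_left mult_minus_left)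
    moreover have "0 < (lam i - mu k) / (lam i - lam k)" if "k < m" "k \<noteq> i" for k
      using that i lm[of i k] ml[of k i] ll[of i k] ll[of k i]
      by (cases "k < i") (auto intro: divide_pos_pos divide_neg_neg)
    ultimately show "0 < - (\<Prod>k<m. lam i - mu k) / (\<Prod>k\<in>{..<m} - {i}. lam i - lam k)"
      using lm[of i i] i by (auto intro!: mult_pos_pos prod_pos)
    have "(\<Prod>k<m. mu i - lam k) / (\<Prod>k\<in>{..<m} - {i}. mu i - mu k)
        = (mu i - lam i) * (\<Prod>k\<in>{..<m} - {i}. (mu i - lam k) / (mu i - mu k))"
      using i by (simp add: prod.remove[of "{..<m}" i] prod_dividef)
    moreover have "0 < (mu i - lam k) / (mu i - mu k)" if "k < m" "k \<noteq> i" for k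
      using that i lm[of k i] ml[of i k] mm[of i k] mm[of k i]
      by (cases "k < i") (auto intro: divide_pos_pos divide_neg_neg)
    ultimately show "0 < (\<Prod>k<m. mu i - lam k) / (\<Prod>k\<in>{..<m} - {i}. mu i - mu k)"
      using lm[of i i] i by (auto intro!: mult_pos_pos prod_pos)
  qed
qed

text \<open>Apply the even case to \<open>X \<union> {M}\<close> with \<open>(t - M) N(t)\<close> and let \<open>M \<rightarrow> \<infinity>\<close>.\<close>

lemma opmono_divdiff_odd:
  assumes F: "opmono {a..} F" and X: "finite X" "X \<subseteq> {a..}" "card X = 2 * m + 1" and N: "degree N < m"
  shows "divdiff (\<lambda>t. (poly N t)\<^sup>2 * F t) X \<le> 0"
proof -
  let ?G = "\<lambda>t. (poly N t)\<^sup>2 * F t"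
  let ?c = "divdiff (\<lambda>t. t * ?G t) X"
  \<comment> \<open>One factor \<open>t - M\<close> of the square removes the node \<open>M\<close>;
    the other turns the value into \<open>?c - M * divdiff ?G X\<close>.\<close>
  have ev: "divdiff ?G X \<le> ?c / M" if M: "M > Max (insert 0 (insert a X))" for M
  proof -
    have M': "M > 0" "M > a" "\<And>x. x \<in> X \<Longrightarrow> x < M" using M X(1) by auto
    then have nin: "M \<notin> X" by auto
    have "degree ([:- M, 1:] * N) < m + 1"
      using degree_mult_le[of "[:- M, 1:]" N] N by simp
    then have "0 \<le> divdiff (\<lambda>t. (poly ([:- M, 1:] * N) t)\<^sup>2 * F t) (insert M X)"
      using X nin M'(2) by (intro opmono_divdiff_even[OF F, of _ "m + 1"]) auto
    also have "\<dots> = divdiff (\<lambda>t. (t - M) * ((t - M) * ?G t)) (insert M X)"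
      by (rule divdiff_cong) (simp add: power2_eq_square algebra_simps)
    also have "\<dots> = divdiff (\<lambda>t. (t - M) * ?G t) X"
      using divdiff_mult_diff[of "insert M X" M] X(1) nin by simp
    also have "\<dots> = divdiff (\<lambda>t. t * ?G t + (- M) * ?G t) X"
      by (rule divdiff_cong) (simp add: algebra_simps)
    also have "\<dots> = ?c - M * divdiff ?G X"
      by (simp only: divdiff_add divdiff_cmult)
    finally show ?thesis using M'(1) by (simp add: field_simps)
  qed
  have "((\<lambda>M. ?c / M) \<longlongrightarrow> 0) at_top"
    by (intro tendsto_divide_0[OF tendsto_const] filterlim_at_top_imp_at_infinity filterlim_ident)
  moreover have "\<forall>\<^sub>F M in at_top. divdiff ?G X \<le> ?c / M"
    using eventually_gt_at_top[of "Max (insert 0 (insert a X))"] by (rule eventually_mono) (rule ev)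
  ultimately show ?thesis by (rule tendsto_lowerbound[OF _ _ trivial_limit_at_top_linorder])
qed

section \<open>Polynomials nonnegative on the half-line\<close>

text \<open>\<open>d\<close> bounds the degree of each summand, not only of the sum, because the
  number of nodes limits the degree of every polynomial that is squared in the divided-difference
  inequalities.\<close>

inductive_set nonneg_polys :: "nat \<Rightarrow> real poly set" for d :: nat where
  square: "2 * degree q \<le> d \<Longrightarrow> q\<^sup>2 \<in> nonneg_polys d"
| x_square: "2 * degree q + 1 \<le> d \<Longrightarrow> [:0, 1:] * q\<^sup>2 \<in> nonneg_polys d"
| add: "p \<in> nonneg_polys d \<Longrightarrow> q \<in> nonneg_polys d \<Longrightarrow> p + q \<in> nonneg_polys d"

lemma nonneg_polys_mono:
  assumes "p \<in> nonneg_polys d" "d \<le> e"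
  shows "p \<in> nonneg_polys e"
  using assms(1)
proof induction
  case (square q)
  then show ?case using assms(2) by (intro nonneg_polys.square) simp
next
  case (x_square q)
  then show ?case using assms(2) by (intro nonneg_polys.x_square) simp
qed (rule nonneg_polys.add)

lemma nonneg_polys_mult_square:
  assumes "p \<in> nonneg_polys d"
  shows "r\<^sup>2 * p \<in> nonneg_polys (d + 2 * degree r)"
  using assms
proof induction
  case (square q)
  have "(r * q)\<^sup>2 \<in> nonneg_polys (d + 2 * degree r)"
    using square degree_mult_le[of r q] by (intro nonneg_polys.square) linarith
  then show ?case by (simp add: power_mult_distrib)
next
  case (x_square q)
  have "[:0, 1:] * (r * q)\<^sup>2 \<in> nonneg_polys (d + 2 * degree r)"
    using x_square degree_mult_le[of r q] by (intro nonneg_polys.x_square) linarith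
  then show ?case by (simp add: power_mult_distrib mult.left_commute)
next
  case (add p q)
  then show ?case by (auto simp: distrib_left intro: nonneg_polys.add)
qed

lemma nonneg_polys_mult_x:
  assumes "p \<in> nonneg_polys d"
  shows "[:0, 1:] * p \<in> nonneg_polys (Suc d)"
  using assms
proof induction
  case (square q)
  then show ?case by (intro nonneg_polys.x_square) linarith
next
  case (x_square q)
  have "([:0, 1:] * q)\<^sup>2 \<in> nonneg_polys (Suc d)"
    using x_square degree_mult_le[of "[:0, 1:]" q] by (intro nonneg_polys.square) simp
  then show ?case by (simp add: power2_eq_square mult_ac)
next
  case (add p q)
  then show ?case unfolding distrib_left by (intro nonneg_polys.add)
qed

lemma poly_nonneg_right_limit:
  fixes p :: "real poly"
  assumes "\<And>s. a < s \<Longrightarrow> 0 \<le> poly p s"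
  shows "0 \<le> poly p a"
proof (rule tendsto_lowerbound)
  show "(poly p \<longlongrightarrow> poly p a) (at_right a)"
    by (intro isCont_tendsto_compose[of _ "poly p"] tendsto_ident_at poly_isCont)
  show "\<forall>\<^sub>F s in at_right a. 0 \<le> poly p s"
    using assms eventually_at_right_less[of a] by (auto elim: eventually_mono)
qed simp

lemma poly_nonpos_left_limit:
  fixes p :: "real poly"
  assumes "b < a" "\<And>s. b < s \<Longrightarrow> s < a \<Longrightarrow> poly p s \<le> 0"
  shows "poly p a \<le> 0"
proof (rule tendsto_upperbound)
  show "(poly p \<longlongrightarrow> poly p a) (at_left a)"
    by (intro isCont_tendsto_compose[of _ "poly p"] tendsto_ident_at poly_isCont)
  show "\<forall>\<^sub>F s in at_left a. poly p s \<le> 0"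
    using assms by (intro eventually_at_leftI[of b]) auto
qed simp

lemma const_nonneg_polys: "0 \<le> c \<Longrightarrow> [:c:] \<in> nonneg_polys d"
  using nonneg_polys.square[of "[:sqrt c:]" d] by (simp add: power2_eq_square)

text \<open>The leading coefficient cannot be negative. In \<open>p = c + t q(t)\<close> the
  polynomial \<open>q\<close> is eventually positive, so \<open>p\<close> stays at or above
  \<open>p(0)\<close> outside a compact interval, and on that interval a minimum exists.\<close>

lemma poly_attains_min:
  fixes p :: "real poly"
  assumes "0 < degree p" "\<And>s. 0 \<le> s \<Longrightarrow> 0 \<le> poly p s"
  obtains r where "0 \<le> r" "\<And>s. 0 \<le> s \<Longrightarrow> poly p r \<le> poly p s"
proof -
  have lc: "0 < lead_coeff p"
  proof (rule ccontr)
    assume "\<not> ?thesis"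
    moreover have "lead_coeff p \<noteq> 0" using assms(1) by auto
    ultimately have neg: "0 < lead_coeff (- p)" by (simp add: not_less less_le)
    then obtain n where n: "\<And>x. x \<ge> n \<Longrightarrow> lead_coeff (- p) \<le> poly (- p) x"
      using poly_pinfty_gt_lc by blast
    have "lead_coeff (- p) \<le> poly (- p) (max n 0)" by (rule n) simp
    moreover have "0 \<le> poly p (max n 0)" by (rule assms(2)) simp
    ultimately show False using neg by simp
  qed
  obtain c q where p: "p = pCons c q" by (cases p)
  have q: "lead_coeff q = lead_coeff p" using assms(1) p by (auto split: if_splits)
  then obtain n where n: "\<And>x. x \<ge> n \<Longrightarrow> lead_coeff q \<le> poly q x"
    using poly_pinfty_gt_lc[of q] lc by auto
  define R where "R = max n 0"
  have R: "poly p 0 \<le> poly p x" if "x \<ge> R" for x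
  proof -
    have "0 \<le> poly q x" using n[of x] that lc q by (simp add: R_def)
    then show ?thesis using that by (simp add: p R_def)
  qed
  obtain r where r: "r \<in> {0..R}" "\<forall>s\<in>{0..R}. poly p r \<le> poly p s"
    using continuous_attains_inf[of "{0..R}" "poly p"] by (auto simp: R_def continuous_on_poly)
  have "poly p r \<le> poly p s" if "0 \<le> s" for s
  proof (cases "s \<le> R")
    case False
    moreover have "poly p r \<le> poly p 0" using r by (auto simp: R_def)
    ultimately show ?thesis using R[of s] by simp
  qed (use r that in auto)
  then show ?thesis using that r by auto
qed

text \<open>Subtracting the minimum over \<open>[0, \<infinity>)\<close> creates a root there, which is double unless it is \<open>0\<close>.\<close>

theorem nonneg_poly_in_nonneg_polys:
  fixes p :: "real poly"
  assumes "\<And>s. 0 < s \<Longrightarrow> 0 \<le> poly p s"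
  shows "p \<in> nonneg_polys (degree p)"
  using assms
proof (induction "degree p" arbitrary: p rule: less_induct)
  case less
  have nn: "0 \<le> poly p s" if "0 \<le> s" for s
    using poly_nonneg_right_limit[of 0 p] less.prems that by (cases "s = 0") auto
  show ?case
  proof (cases "degree p = 0")
    case True
    then obtain c where "p = [:c:]" by (rule degree_eq_zeroE)
    then show ?thesis using nn[of 0] const_nonneg_polys by simp
  next
    case False
    then obtain r where r: "0 \<le> r" "\<And>s. 0 \<le> s \<Longrightarrow> poly p r \<le> poly p s"
      using poly_attains_min[of p] nn by auto
    define c where "c = poly p r"
    define q where "q = p + [:- c:]"
    have dq: "degree q = degree p"
      using False degree_add_eq_left[of "[:- c:]" p] by (simp add: q_def)
    have q0: "q \<noteq> 0" using dq False by auto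
    have qnn: "0 \<le> poly q s" if "0 \<le> s" for s using r(2)[OF that] by (simp add: q_def c_def)
    have qr: "poly q r = 0" by (simp add: q_def c_def)
    have "q \<in> nonneg_polys (degree p)"
    proof (cases "r = 0")
      case True
      then obtain q1 where q1: "q = [:0, 1:] * q1" using qr by (auto simp: poly_eq_0_iff_dvd)
      have d1: "degree p = Suc (degree q1)" using dq q0 unfolding q1 by (subst (asm) degree_mult_eq) auto
      have "0 \<le> poly q1 s" if "0 < s" for s
        using qnn[of s] that by (simp add: q1 zero_le_mult_iff)
      then have "q1 \<in> nonneg_polys (degree q1)" using less.hyps[of q1] d1 by simp
      then show ?thesis unfolding q1 d1 by (rule nonneg_polys_mult_x)
    next
      case False
      then have r0: "0 < r" using r by simp
      obtain q1 where q1: "q = [:- r, 1:] * q1" using qr by (auto simp: poly_eq_0_iff_dvd)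
      have qs: "poly q s = (s - r) * poly q1 s" for s by (simp add: q1 algebra_simps)
      \<comment> \<open>The quotient \<open>q1\<close> is nonnegative to the right of
        \<open>r\<close> and nonpositive to the left, so it vanishes at \<open>r\<close> and the
        root is double.\<close>
      have "0 \<le> poly q1 s" if "r < s" for s
        using qnn[of s] that r0 by (simp add: qs zero_le_mult_iff)
      then have "0 \<le> poly q1 r" by (rule poly_nonneg_right_limit)
      moreover have "poly q1 s \<le> 0" if "0 < s" "s < r" for s
        using qnn[of s] that by (simp add: qs zero_le_mult_iff)
      then have "poly q1 r \<le> 0" by (rule poly_nonpos_left_limit[OF r0])
      ultimately obtain q2 where q2: "q1 = [:- r, 1:] * q2" by (auto simp: poly_eq_0_iff_dvd)
      have q: "q = [:- r, 1:]\<^sup>2 * q2" by (simp only: q1 q2 power2_eq_square mult.assoc)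
      have d2: "degree p = degree q2 + 2 * degree [:- r, 1:]"
        using dq q0 unfolding q by (subst (asm) degree_mult_eq) (auto simp: degree_power_eq)
      have ne: "0 \<le> poly q2 s" if "0 \<le> s" "s \<noteq> r" for s
      proof -
        have "poly q s = (s - r)\<^sup>2 * poly q2 s" by (simp add: qs q2 power2_eq_square algebra_simps)
        then have "0 \<le> (s - r)\<^sup>2 * poly q2 s" using qnn[OF that(1)] by simp
        then show ?thesis using that by (simp add: zero_le_mult_iff)
      qed
      \<comment> \<open>At \<open>r\<close> itself the factor \<open>(s - r)^2\<close> hides the
        sign of \<open>q2\<close>; the limit from the right supplies it.\<close>
      have "0 \<le> poly q2 r"
      proof (rule poly_nonneg_right_limit)
        fix s assume "r < s"
        then show "0 \<le> poly q2 s" using r0 by (intro ne) auto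
      qed
      then have "0 \<le> poly q2 s" if "0 < s" for s using ne[of s] that by (cases "s = r") auto
      then have "q2 \<in> nonneg_polys (degree q2)" using less.hyps[of q2] d2 by simp
      then show ?thesis unfolding q d2 by (rule nonneg_polys_mult_square)
    qed
    moreover have "[:c:] \<in> nonneg_polys (degree p)"
      using nn[OF r(1)] by (intro const_nonneg_polys) (simp add: c_def)
    ultimately have "q + [:c:] \<in> nonneg_polys (degree p)" by (rule nonneg_polys.add)
    then show ?thesis by (simp add: q_def add.assoc)
  qed
qed

section \<open>Functionals nonnegative on operator monotone functions\<close>

lemma qform_add_const:
  assumes "unitary_mat n U" "w \<in> carrier_vec n"
  shows "qform n U (\<lambda>i. d i + c) w = qform n U d w + c * Re (w \<bullet>c w)"
  unfolding qform_one[OF assms, symmetric]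
  by (simp add: qform_def distrib_right sum.distrib sum_distrib_left)

lemma opmono_shift:
  assumes "opmono T F" "\<And>s. s \<in> S \<Longrightarrow> s + c \<in> T"
  shows "opmono S (\<lambda>t. F (t + c))"
  unfolding opmono_def
proof (intro allI impI, goal_cases)
  case (1 n U V d e)
  have "\<forall>w\<in>carrier_vec n. qform n U (\<lambda>i. d i + c) w \<le> qform n V (\<lambda>i. e i + c) w"
    using 1 by (simp add: qform_add_const)
  then show ?case
    using assms(1)[unfolded opmono_def, rule_format, of n U V "\<lambda>i. d i + c" "\<lambda>i. e i + c"] 1 assms(2)
    by (auto simp: image_subset_iff)
qed

text \<open>Over a common denominator the sum in \<open>c2\<close> is
  \<open>- P(s) / \<Prod>(y + s)\<close>, so \<open>c2\<close> makes \<open>P\<close> nonnegative on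
  the positive axis and \<open>c1\<close> removes its coefficient of degree \<open>n - 1\<close>.
  \<open>F\<close> is taken on a half-line containing 0, while \<open>X\<close> avoids 0, because
  the terms \<open>s r^2\<close> of \<open>P\<close> use 0 as an additional node.\<close>

lemma opmono_functional_nonneg_aux:
  assumes F: "opmono {0..} F" and X: "finite X" "X \<subseteq> {0<..}"
    and c1: "(\<Sum>x\<in>X. c x) = 0" and c2: "\<And>s. 0 < s \<Longrightarrow> (\<Sum>x\<in>X. c x / (x + s)) \<le> 0"
  shows "0 \<le> (\<Sum>x\<in>X. c x * F x)"
proof (cases "card X \<le> 1")
  case True
  then have "X = {} \<or> (\<exists>x. X = {x})"
    using X(1) by (metis card_0_eq card_1_singletonE le_eq_less_or_eq less_one)
  then show ?thesis using c1 by auto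
next
  case False
  have XS: "X \<subseteq> {0..}" using X(2) by force
  define n where "n = card X"
  have n: "2 \<le> n" using False by (simp add: n_def)
  define Pi where "Pi x = (\<Prod>y\<in>X - {x}. [:y, 1:])" for x
  have dPi: "degree (Pi x) = n - 1" "coeff (Pi x) (n - 1) = 1" if "x \<in> X" for x
  proof -
    show d: "degree (Pi x) = n - 1"
      using that X(1) unfolding Pi_def n_def by (subst degree_prod_eq_sum_degree) auto
    have "lead_coeff (Pi x) = 1" by (simp add: Pi_def lead_coeff_prod)
    then show "coeff (Pi x) (n - 1) = 1" using d by simp
  qed
  define P where "P = - (\<Sum>x\<in>X. Polynomial.smult (c x) (Pi x))"
  have "degree P \<le> n - 1"
    unfolding P_def degree_minus by (intro degree_sum_le X(1) order_trans[OF degree_smult_le]) (simp add: dPi)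
  moreover have "coeff P (n - 1) = 0"
    using c1 by (simp add: P_def coeff_sum dPi del: One_nat_def)
  ultimately have "degree P \<le> n - 2"
    using n by (metis Suc_1 Suc_diff_Suc Suc_le_lessD coeff_eq_0 degree_0 diff_Suc_1 eq_zero_or_degree_less le_SucE leading_coeff_0_iff zero_le)
  moreover have "0 \<le> poly P s" if s: "0 < s" for s
  proof -
    have "poly P s = - ((\<Prod>y\<in>X. y + s) * (\<Sum>x\<in>X. c x / (x + s)))"
      unfolding P_def sum_distrib_left poly_minus poly_sum
    proof (intro arg_cong[where f = uminus] sum.cong refl)
      fix x assume x: "x \<in> X"
      then have "x + s \<noteq> 0" using X s by auto
      then show "poly (Polynomial.smult (c x) (Pi x)) s = (\<Prod>y\<in>X. y + s) * (c x / (x + s))"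
        using x X(1) by (simp add: Pi_def poly_prod prod.remove)
    qed
    moreover have "0 \<le> (\<Prod>y\<in>X. y + s)" using X s by (intro prod_nonneg) auto
    ultimately show ?thesis using c2[OF s] by (simp add: mult_nonneg_nonpos)
  qed
  ultimately have P: "P \<in> nonneg_polys (n - 2)"
    using nonneg_poly_in_nonneg_polys nonneg_polys_mono by blast
  \<comment> \<open>At \<open>- x\<close> only the term of \<open>x\<close> in \<open>P\<close>
    survives. Its minus sign and the \<open>(-1)^(n - 1)\<close> from reversing the factors
    \<open>y - x\<close> combine to \<open>(-1)^n\<close>, the sign carried by the inequality over
    \<open>n\<close> nodes.\<close>
  have cx: "c x * F x = (-1) ^ n * (poly P (- x) * F x / (\<Prod>y\<in>X - {x}. x - y))" if x: "x \<in> X" for x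
  proof -
    have "poly (Pi z) (- x) = 0" if "z \<in> X" "z \<noteq> x" for z
      using that x X(1) by (auto simp: Pi_def poly_prod intro!: bexI[of _ x])
    then have "poly P (- x) = - (c x * poly (Pi x) (- x))"
      using x X(1) by (simp add: P_def poly_sum sum.remove[of X x])
    also have "poly (Pi x) (- x) = (\<Prod>y\<in>X - {x}. (-1) * (x - y))"
      by (simp add: Pi_def poly_prod)
    also have "\<dots> = (-1) ^ (n - 1) * (\<Prod>y\<in>X - {x}. x - y)"
      unfolding prod.distrib using x X(1) by (simp add: n_def)
    finally have "poly P (- x) = (-1) ^ n * c x * (\<Prod>y\<in>X - {x}. x - y)"
      using n by (cases n) auto
    moreover have "(\<Prod>y\<in>X - {x}. x - y) \<noteq> 0" using X(1) by auto
    moreover have "(-1) ^ n * (-1) ^ n = (1::real)" by (simp flip: power_mult_distrib)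
    ultimately show ?thesis by (simp add: mult.assoc[symmetric])
  qed
  then have "(\<Sum>x\<in>X. c x * F x) = (-1) ^ n * divdiff (\<lambda>t. poly P (- t) * F t) X"
    by (simp add: divdiff_def sum_distrib_left)
  also have "\<dots> \<ge> 0"
    using P
  proof induction
    case (square q)
    define N where "N = pcompose q [:0, -1:]"
    have N: "poly N t = poly q (- t)" "degree N \<le> degree q" for t
      using degree_pcompose_le[of q "[:0,-1:]"] by (simp_all add: N_def poly_pcompose)
    have "divdiff (\<lambda>t. poly (q\<^sup>2) (- t) * F t) X = divdiff (\<lambda>t. (poly N t)\<^sup>2 * F t) X"
      by (simp add: N)
    moreover have "0 \<le> (-1) ^ n * divdiff (\<lambda>t. (poly N t)\<^sup>2 * F t) X"
    proof (cases "even n")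
      case True
      then obtain m where m: "n = 2 * m" by (elim evenE)
      then show ?thesis
        using opmono_divdiff_even[OF F X(1) XS, of m N] square N(2) n by (auto simp: n_def)
    next
      case False
      then obtain m where m: "n = 2 * m + 1" by (elim oddE)
      then show ?thesis
        using opmono_divdiff_odd[OF F X(1) XS, of m N] square N(2) n by (auto simp: n_def)
    qed
    ultimately show ?case by simp
  next
    case (x_square q)
    \<comment> \<open>Evaluated at \<open>- t\<close> the term is
      \<open>- t q(- t)^2 = - N(t)^2 / t\<close>, and dividing by \<open>t\<close> amounts to adding
      the node 0. This changes the parity of the number of nodes, hence the sign of the inequality,
      which absorbs the minus sign.\<close>
    define N where "N = [:0, 1:] * pcompose q [:0, -1:]"
    have N: "poly N t = t * poly q (- t)" "degree N \<le> degree q + 1" for t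
      using degree_pcompose_le[of q "[:0,-1:]"] degree_mult_le[of "[:0, 1:]" "pcompose q [:0, -1:]"]
      by (simp_all add: N_def poly_pcompose)
    let ?X = "insert 0 X"
    have X0: "0 \<notin> X" using X(2) by auto
    then have X1: "?X \<subseteq> {0..}" "card ?X = n + 1" using X XS by (simp_all add: n_def)
    have "divdiff (\<lambda>t. (poly N t)\<^sup>2 * F t) ?X = divdiff (\<lambda>t. (t - 0) * (t * (poly q (- t))\<^sup>2 * F t)) ?X"
      by (rule divdiff_cong) (simp add: N power2_eq_square)
    also have "\<dots> = divdiff (\<lambda>t. t * (poly q (- t))\<^sup>2 * F t) X"
      using X0 X(1) by (subst divdiff_mult_diff) auto
    also have "\<dots> = - divdiff (\<lambda>t. (-1) * (t * (poly q (- t))\<^sup>2 * F t)) X"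
      unfolding divdiff_cmult by simp
    also have "divdiff (\<lambda>t. (-1) * (t * (poly q (- t))\<^sup>2 * F t)) X = divdiff (\<lambda>t. poly ([:0, 1:] * q\<^sup>2) (- t) * F t) X"
      by (rule divdiff_cong) simp
    finally have *: "divdiff (\<lambda>t. poly ([:0, 1:] * q\<^sup>2) (- t) * F t) X = - divdiff (\<lambda>t. (poly N t)\<^sup>2 * F t) ?X"
      by simp
    show ?case
    proof (cases "even n")
      case True
      then obtain m where m: "n = 2 * m" by (elim evenE)
      then show ?thesis unfolding *
        using opmono_divdiff_odd[OF F _ X1(1), of m N] X1(2) X(1) x_square N(2) n by auto
    next
      case False
      then obtain m where m: "n = 2 * m + 1" by (elim oddE)
      then show ?thesis unfolding *
        using opmono_divdiff_even[OF F _ X1(1), of "m + 1" N] X1(2) X(1) x_square N(2) n by auto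
    qed
  next
    case (add p q)
    then show ?case by (simp add: distrib_right divdiff_add distrib_left)
  qed
  finally show ?thesis .
qed

text \<open>Near 0 the function may be unbounded, so the shifts \<open>F(t + s)\<close>, which are
  operator monotone on the closed half-line, are used and \<open>s\<close> tends to 0.\<close>

lemma opmono_functional_nonneg:
  assumes F: "opmono {0<..} F" "continuous_on {0<..} F" and X: "finite X" "X \<subseteq> {0<..}"
    and c: "(\<Sum>x\<in>X. c x) = 0" "\<And>s. 0 < s \<Longrightarrow> (\<Sum>x\<in>X. c x / (x + s)) \<le> 0"
  shows "0 \<le> (\<Sum>x\<in>X. c x * F x)"
proof (rule tendsto_lowerbound)
  have "((\<lambda>s. F (x + s)) \<longlongrightarrow> F x) (at_right 0)" if "x \<in> X" for x
  proof -
    have "isCont F x" using F(2) X that by (auto simp: continuous_on_eq_continuous_at)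
    moreover have "((\<lambda>s. x + s) \<longlongrightarrow> x + 0) (at_right 0)" by (intro tendsto_intros)
    ultimately show ?thesis by (intro isCont_tendsto_compose[of x F]) auto
  qed
  then show "((\<lambda>s. \<Sum>x\<in>X. c x * F (x + s)) \<longlongrightarrow> (\<Sum>x\<in>X. c x * F x)) (at_right 0)"
    by (intro tendsto_sum tendsto_mult tendsto_const)
  have "0 \<le> (\<Sum>x\<in>X. c x * F (x + s))" if "0 < s" for s
    using that by (intro opmono_functional_nonneg_aux[OF opmono_shift[OF F(1)] X c]) auto
  then show "\<forall>\<^sub>F s in at_right 0. 0 \<le> (\<Sum>x\<in>X. c x * F (x + s))"
    using eventually_at_right_less[of 0] by (auto elim: eventually_mono)
qed simp

section \<open>Transformations given by finitely supported functionals\<close>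

definition point_functional :: "real set \<Rightarrow> ((real \<Rightarrow> real) \<Rightarrow> real) \<Rightarrow> bool" where
  "point_functional S L \<longleftrightarrow> (\<exists>X c. finite X \<and> X \<subseteq> S \<and> (\<forall>F. L F = (\<Sum>x\<in>X. c x * F x)))"

lemma point_functional_eval: "x \<in> S \<Longrightarrow> point_functional S (\<lambda>F. F x)"
  unfolding point_functional_def by (intro exI[of _ "{x}"] exI[of _ "\<lambda>_. 1"]) auto

lemma point_functional_cmult:
  assumes "point_functional S L"
  shows "point_functional S (\<lambda>F. k * L F)"
proof -
  obtain X c where X: "finite X" "X \<subseteq> S" "\<And>F. L F = (\<Sum>x\<in>X. c x * F x)"
    using assms unfolding point_functional_def by blast
  show ?thesis
    unfolding point_functional_def
    by (intro exI[of _ X] exI[of _ "\<lambda>x. k * c x"]) (simp add: X sum_distrib_left mult.assoc)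
qed

lemma point_functional_add:
  assumes "point_functional S L" "point_functional S L'"
  shows "point_functional S (\<lambda>F. L F + L' F)"
proof -
  obtain X c where X: "finite X" "X \<subseteq> S" "\<And>F. L F = (\<Sum>x\<in>X. c x * F x)"
    using assms(1) unfolding point_functional_def by blast
  obtain X' c' where X': "finite X'" "X' \<subseteq> S" "\<And>F. L' F = (\<Sum>x\<in>X'. c' x * F x)"
    using assms(2) unfolding point_functional_def by blast
  let ?c = "\<lambda>x. (if x \<in> X then c x else 0) + (if x \<in> X' then c' x else 0)"
  have "L F + L' F = (\<Sum>x\<in>X \<union> X'. ?c x * F x)" for F
  proof -
    have "L F = (\<Sum>x\<in>X \<union> X'. (if x \<in> X then c x else 0) * F x)"
      unfolding X(3) using X(1) X'(1) by (intro sum.mono_neutral_cong_left) auto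
    moreover have "L' F = (\<Sum>x\<in>X \<union> X'. (if x \<in> X' then c' x else 0) * F x)"
      unfolding X'(3) using X(1) X'(1) by (intro sum.mono_neutral_cong_left) auto
    ultimately show ?thesis by (simp only: sum.distrib distrib_right)
  qed
  then show ?thesis
    unfolding point_functional_def using X X' by (intro exI[of _ "X \<union> X'"] exI[of _ ?c]) auto
qed

lemma point_functional_sum:
  assumes "\<And>i. i < (n::nat) \<Longrightarrow> point_functional S (L i)"
  shows "point_functional S (\<lambda>F. \<Sum>i<n. L i F)"
  using assms
proof (induction n)
  case 0
  show ?case unfolding point_functional_def by (intro exI[of _ "{}"]) auto
next
  case (Suc n)
  then show ?case by (auto intro!: point_functional_add)
qed

text \<open>A transformation that acts pointwise by finitely supported functionals and kills constants
  preserves operator monotonicity on \<open>(0, \<infinity>)\<close> as soon as it does so for \<open>t \<mapsto> - 1 / (t + s)\<close>.\<close>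

lemma opmono_transform:
  fixes T :: "(real \<Rightarrow> real) \<Rightarrow> real \<Rightarrow> real"
  assumes F: "opmono {0<..} F" "continuous_on {0<..} F"
    and T: "\<And>t. t \<in> S \<Longrightarrow> point_functional {0<..} (\<lambda>F. T F t)"
    and T1: "\<And>t. t \<in> S \<Longrightarrow> T (\<lambda>_. 1) t = 0"
    and Ts: "\<And>s. 0 < s \<Longrightarrow> opmono S (\<lambda>t. - T (\<lambda>u. 1 / (u + s)) t)"
  shows "opmono S (T F)"
  unfolding opmono_def
proof (intro allI impI ballI)
  fix n U V d e and w :: "complex Matrix.vec"
  assume *: "unitary_mat n U" "unitary_mat n V" "d ` {..<n} \<subseteq> S" "e ` {..<n} \<subseteq> S"
    "\<forall>w\<in>carrier_vec n. qform n U d w \<le> qform n V e w" "w \<in> carrier_vec n"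
  \<comment> \<open>For fixed matrices and fixed \<open>w\<close> the desired inequality says that
    one finitely supported functional is nonnegative at \<open>F\<close>, so only its values on
    constants and on \<open>1 / (u + s)\<close> have to be checked.\<close>
  define L where "L F = qform n V (\<lambda>i. T F (e i)) w + (-1) * qform n U (\<lambda>i. T F (d i)) w" for F
  have "point_functional {0<..} (\<lambda>F. qform n W (\<lambda>i. T F (g i)) w)" if "g ` {..<n} \<subseteq> S" for W g
  proof -
    have "point_functional {0<..} (\<lambda>F. \<Sum>i<n. (cmod (coord W w i))\<^sup>2 * T F (g i))"
      using that by (intro point_functional_sum point_functional_cmult T) auto
    then show ?thesis by (simp add: qform_def mult.commute)
  qed
  then have "point_functional {0<..} L"
    unfolding L_def using * by (intro point_functional_add point_functional_cmult)
  then obtain X c where X: "finite X" "X \<subseteq> {0<..}" "\<And>F. L F = (\<Sum>x\<in>X. c x * F x)"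
    unfolding point_functional_def by blast
  have "0 \<le> L F"
    unfolding X(3)
  proof (rule opmono_functional_nonneg[OF F X(1,2)])
    have "L (\<lambda>_. 1) = 0"
      using * by (simp add: L_def qform_def T1 image_subset_iff)
    then show "sum c X = 0" by (simp add: X(3))
    fix s :: real assume s: "0 < s"
    have "L (\<lambda>u. 1 / (u + s)) \<le> 0"
      using Ts[OF s, unfolded opmono_def, rule_format, OF *(1-4) *(5)[rule_format] *(6)]
      by (simp add: L_def qform_def sum_negf)
    then show "(\<Sum>x\<in>X. c x / (x + s)) \<le> 0" by (simp add: X(3))
  qed
  then show "qform n U (\<lambda>i. T F (d i)) w \<le> qform n V (\<lambda>i. T F (e i)) w"
    by (simp add: L_def)
qed

section \<open>Closure properties of operator monotone functions\<close>

lemma opmono_subset: "opmono T F \<Longrightarrow> S \<subseteq> T \<Longrightarrow> opmono S F"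
  using opmono_shift[of T F S 0] by auto

lemma qform_cong: "(\<And>i. i < n \<Longrightarrow> d i = e i) \<Longrightarrow> qform n U d w = qform n U e w"
  by (simp add: qform_def)

lemma opmono_cong:
  assumes "opmono S F" "\<And>t. t \<in> S \<Longrightarrow> F t = G t"
  shows "opmono S G"
  unfolding opmono_def
proof (intro allI impI, goal_cases)
  case (1 n U V d e)
  have "qform n U (\<lambda>i. G (d i)) w = qform n U (\<lambda>i. F (d i)) w" "qform n V (\<lambda>i. G (e i)) w = qform n V (\<lambda>i. F (e i)) w" for w
    using 1(3,4) assms(2) by (auto intro!: qform_cong)
  then show ?case using assms(1)[unfolded opmono_def, rule_format, OF 1(1-4)] 1(5) by simp
qed

lemma opmono_compose:
  assumes "opmono S F" "opmono T G" "\<And>t. t \<in> S \<Longrightarrow> F t \<in> T"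
  shows "opmono S (\<lambda>t. G (F t))"
  unfolding opmono_def
proof (intro allI impI, goal_cases)
  case (1 n U V d e)
  have "\<forall>w\<in>carrier_vec n. qform n U (\<lambda>i. F (d i)) w \<le> qform n V (\<lambda>i. F (e i)) w"
    using assms(1) 1 unfolding opmono_def by blast
  moreover have "(\<lambda>i. F (d i)) ` {..<n} \<subseteq> T" "(\<lambda>i. F (e i)) ` {..<n} \<subseteq> T"
    using 1(3,4) assms(3) by auto
  ultimately show ?case using assms(2)[unfolded opmono_def, rule_format, OF 1(1,2)] by blast
qed

lemma opmono_add:
  assumes "opmono S F" "opmono S G"
  shows "opmono S (\<lambda>t. F t + G t)"
  unfolding opmono_def
proof (intro allI impI ballI, goal_cases)
  case (1 n U V d e w)
  have "qform n U (\<lambda>i. F (d i)) w \<le> qform n V (\<lambda>i. F (e i)) w"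
    "qform n U (\<lambda>i. G (d i)) w \<le> qform n V (\<lambda>i. G (e i)) w"
    using assms 1 unfolding opmono_def by blast+
  then show ?case by (simp add: qform_def distrib_right sum.distrib)
qed

lemma opmono_cmult:
  assumes "opmono S F" "0 \<le> c"
  shows "opmono S (\<lambda>t. c * F t)"
  unfolding opmono_def
proof (intro allI impI ballI, goal_cases)
  case (1 n U V d e w)
  have "qform n U (\<lambda>i. F (d i)) w \<le> qform n V (\<lambda>i. F (e i)) w"
    using assms 1 unfolding opmono_def by blast
  then have "c * qform n U (\<lambda>i. F (d i)) w \<le> c * qform n V (\<lambda>i. F (e i)) w"
    using assms(2) by (rule mult_left_mono)
  then show ?case by (simp add: qform_def sum_distrib_left mult.assoc)
qed

lemma opmono_const: "opmono S (\<lambda>_. c)"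
  unfolding opmono_def
proof (intro allI impI ballI, goal_cases)
  case (1 n U V d e w)
  have "qform n W (\<lambda>_. c) w = c * Re (w \<bullet>c w)" if "unitary_mat n W" for W
    using qform_add_const[OF that 1(6), of "\<lambda>_. 0" c] by (simp add: qform_def)
  then show ?case using 1 by simp
qed

text \<open>Each inequality involves finitely many eigenvalues, so pointwise convergence is enough.
  The sets \<open>T k\<close> vary so that an excluded point may move with \<open>k\<close>.\<close>

lemma opmono_limit:
  assumes "\<And>x. x \<in> S \<Longrightarrow> \<forall>\<^sub>F k in A. x \<in> T k" "\<forall>\<^sub>F k in A. opmono (T k) (G k)"
    and "\<And>x. x \<in> S \<Longrightarrow> ((\<lambda>k. G k x) \<longlongrightarrow> F x) A" and "A \<noteq> bot"
  shows "opmono S F"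
  unfolding opmono_def
proof (intro allI impI ballI)
  fix n U V d e and w :: "complex Matrix.vec"
  assume *: "unitary_mat n U" "unitary_mat n V" "d ` {..<n} \<subseteq> S" "e ` {..<n} \<subseteq> S"
    "\<forall>w\<in>carrier_vec n. qform n U d w \<le> qform n V e w" "w \<in> carrier_vec n"
  have lim: "((\<lambda>k. qform n W (\<lambda>i. G k (g i)) w) \<longlongrightarrow> qform n W (\<lambda>i. F (g i)) w) A"
    if "g ` {..<n} \<subseteq> S" for W g
    unfolding qform_def using that by (intro tendsto_sum tendsto_mult tendsto_const assms(3)) auto
  have sub: "\<forall>\<^sub>F k in A. g ` {..<n} \<subseteq> T k" if "g ` {..<n} \<subseteq> S" for g
  proof -
    have "\<forall>\<^sub>F k in A. \<forall>i\<in>{..<n}. g i \<in> T k"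
      using that by (intro eventually_ball_finite ballI assms(1)) auto
    then show ?thesis by (simp add: image_subset_iff)
  qed
  show "qform n U (\<lambda>i. F (d i)) w \<le> qform n V (\<lambda>i. F (e i)) w"
  proof (rule tendsto_le[OF assms(4) lim[OF *(4)] lim[OF *(3)]])
    show "\<forall>\<^sub>F k in A. qform n U (\<lambda>i. G k (d i)) w \<le> qform n V (\<lambda>i. G k (e i)) w"
      using sub[OF *(3)] sub[OF *(4)] assms(2)
    proof eventually_elim
      case (elim k)
      show ?case
        by (rule elim(3)[unfolded opmono_def, rule_format, OF *(1,2) elim(1,2) *(5)[rule_format] *(6)])
    qed
  qed
qed

lemma eventually_plus_not_in_finite:
  fixes t :: real
  assumes "finite E"
  shows "\<forall>\<^sub>F s in at_right 0. t + s \<notin> E"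
proof -
  have "\<forall>\<^sub>F s in at_right 0. \<forall>x\<in>E. s \<noteq> x - t"
    using assms by (intro eventually_ball_finite ballI eventually_neq_at_within)
  then show ?thesis by eventually_elim auto
qed

text \<open>For small \<open>s > 0\<close> the shifts \<open>x + s\<close> of finitely many
  eigenvalues are positive and avoid \<open>E\<close>; continuity removes the shift.\<close>

lemma opmono_extend:
  assumes F: "continuous_on {0..} F" "opmono ({0<..} - E) F" and E: "finite E"
  shows "opmono {0..} F"
proof (rule opmono_limit)
  show "\<forall>\<^sub>F s in at_right 0. opmono {t. 0 \<le> t \<and> t + s \<notin> E} (\<lambda>t. F (t + s))"
    using eventually_at_right_less[of "0::real"]
    by eventually_elim (rule opmono_shift[OF F(2)], auto)
  fix x :: real assume x: "x \<in> {0..}"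
  show "\<forall>\<^sub>F s in at_right 0. x \<in> {t. 0 \<le> t \<and> t + s \<notin> E}"
    using eventually_plus_not_in_finite[OF E, of x] x by simp
  show "((\<lambda>s. F (x + s)) \<longlongrightarrow> F x) (at_right 0)"
  proof (rule continuous_on_tendsto_compose[OF F(1)])
    have "((\<lambda>s. x + s) \<longlongrightarrow> x + 0) (at_right 0)" by (intro tendsto_intros)
    then show "((\<lambda>s. x + s) \<longlongrightarrow> x) (at_right 0)" by simp
    show "\<forall>\<^sub>F s in at_right 0. x + s \<in> {0..}"
      using eventually_at_right_less[of "0::real"] by eventually_elim (use x in auto)
  qed (use x in auto)
qed simp

section \<open>Operator monotonicity of the negative inverse\<close>

lemma coord_add:
  assumes "U \<in> carrier_mat n n" "w \<in> carrier_vec n" "y \<in> carrier_vec n" "i < n"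
  shows "coord U (w + y) i = coord U w i + coord U y i"
  using assms by (simp add: coord_eq_sum[of _ n] distrib_left sum.distrib)

text \<open>Polarization expresses \<open>Re <w, y>\<close> through norms, so the coordinates may be
  taken in either eigenbasis.\<close>

lemma Re_cscalar_coord:
  assumes U: "unitary_mat n U" and w: "w \<in> carrier_vec n" and y: "y \<in> carrier_vec n"
  shows "2 * (\<Sum>i<n. Re (coord U w i * cnj (coord U y i)))
    = Re ((w + y) \<bullet>c (w + y)) - Re (w \<bullet>c w) - Re (y \<bullet>c y)"
proof -
  have Uc: "U \<in> carrier_mat n n" using U by (simp add: unitary_mat_def)
  have "(cmod (a + b))\<^sup>2 = (cmod a)\<^sup>2 + (cmod b)\<^sup>2 + 2 * Re (a * cnj b)" for a b
    by (simp only: cmod_power2) (simp add: power2_eq_square algebra_simps)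
  then have "qform n U (\<lambda>_. 1) (w + y) = qform n U (\<lambda>_. 1) w + qform n U (\<lambda>_. 1) y
      + 2 * (\<Sum>i<n. Re (coord U w i * cnj (coord U y i)))"
    unfolding qform_def sum_distrib_left sum.distrib[symmetric]
    by (intro sum.cong refl) (simp add: coord_add[OF Uc w y])
  then show ?thesis using U w y by (simp add: qform_one)
qed

text \<open>\<open>\<langle>w, P\<^sup>-\<^sup>1 w\<rangle>\<close> is the maximum over \<open>y\<close> of \<open>2 Re \<langle>w, y\<rangle> - \<langle>y, P y\<rangle>\<close>, which decreases in \<open>P\<close>.\<close>

lemma opmono_neg_inverse: "opmono {0<..} (\<lambda>t. - 1 / t)"
  unfolding opmono_def
proof (intro allI impI ballI)
  fix n U V d e and w :: "complex Matrix.vec"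
  assume *: "unitary_mat n U" "unitary_mat n V" "d ` {..<n} \<subseteq> {0<..}" "e ` {..<n} \<subseteq> {0<..}"
    "\<forall>w\<in>carrier_vec n. qform n U d w \<le> qform n V e w" "w \<in> carrier_vec n"
  have Vc: "V \<in> carrier_mat n n" using * by (simp add: unitary_mat_def)
  \<comment> \<open>\<open>z\<close> holds the coordinates of \<open>y = B^(-1) w\<close>, the
    maximizer for \<open>B = unitary_conj_diag n V e\<close>; the same \<open>y\<close> is the test
    vector for the other matrix.\<close>
  define z where "z = Matrix.vec n (\<lambda>j. coord V w j / of_real (e j))"
  define y where "y = V *\<^sub>v z"
  have z: "z \<in> carrier_vec n" by (simp add: z_def)
  have y: "y \<in> carrier_vec n" using Vc z by (simp add: y_def)
  have "mat_adjoint V *\<^sub>v y = z"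
    unfolding y_def using *(2) Vc z mat_adjoint_carrier[OF Vc]
    by (subst assoc_mult_mat_vec[symmetric, of _ n n _ n]) (auto simp: unitary_mat_def)
  then have yj: "coord V y j = coord V w j / of_real (e j)" if "j < n" for j
    using that by (simp add: coord_def z_def)
  have "qform n V (\<lambda>i. 1 / e i) w = 2 * (\<Sum>i<n. Re (coord V w i * cnj (coord V y i))) - qform n V e y"
    unfolding qform_def sum_distrib_left sum_subtractf[symmetric]
  proof (rule sum.cong[OF refl])
    fix j assume "j \<in> {..<n}"
    then have j: "j < n" "0 < e j" using *(4) by auto
    have "Re (coord V w j * cnj (coord V y j)) = (cmod (coord V w j))\<^sup>2 / e j"
      unfolding yj[OF j(1)] cmod_power2 by (simp add: power2_eq_square add_divide_distrib)
    moreover have "e j * (cmod (coord V y j))\<^sup>2 = (cmod (coord V w j))\<^sup>2 / e j"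
      unfolding yj[OF j(1)] using j(2) by (simp add: norm_divide power_divide power2_eq_square)
    ultimately show "1 / e j * (cmod (coord V w j))\<^sup>2 = 2 * Re (coord V w j * cnj (coord V y j)) - e j * (cmod (coord V y j))\<^sup>2"
      by simp
  qed
  also have "\<dots> \<le> 2 * (\<Sum>i<n. Re (coord U w i * cnj (coord U y i))) - qform n U d y"
    using *(5) y Re_cscalar_coord[OF *(1,6) y] Re_cscalar_coord[OF *(2,6) y] by simp
  also have "\<dots> \<le> qform n U (\<lambda>i. 1 / d i) w"
    unfolding qform_def sum_distrib_left sum_subtractf[symmetric]
  proof (rule sum_mono)
    fix j assume "j \<in> {..<n}"
    then have j: "0 < d j" using *(3) by auto
    let ?a = "coord U w j" and ?b = "coord U y j"
    \<comment> \<open>The arithmetic-geometric mean inequality bounds the contribution of one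
      coordinate.\<close>
    have "2 * (d j * (cmod ?a * cmod ?b)) \<le> (cmod ?a)\<^sup>2 + (d j * cmod ?b)\<^sup>2"
      using sum_squares_bound[of "cmod ?a" "d j * cmod ?b"] by (simp add: mult_ac)
    then have "2 * (cmod ?a * cmod ?b) \<le> ((cmod ?a)\<^sup>2 + (d j * cmod ?b)\<^sup>2) / d j"
      using j by (simp add: field_simps)
    also have "\<dots> = 1 / d j * (cmod ?a)\<^sup>2 + d j * (cmod ?b)\<^sup>2"
      using j by (simp add: field_simps power2_eq_square)
    finally have "2 * (cmod ?a * cmod ?b) \<le> 1 / d j * (cmod ?a)\<^sup>2 + d j * (cmod ?b)\<^sup>2" .
    moreover have "Re (?a * cnj ?b) \<le> cmod ?a * cmod ?b"
      using complex_Re_le_cmod[of "?a * cnj ?b"] by (simp add: norm_mult)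
    ultimately show "2 * Re (?a * cnj ?b) - d j * (cmod ?b)\<^sup>2 \<le> 1 / d j * (cmod ?a)\<^sup>2"
      by linarith
  qed
  finally show "qform n U (\<lambda>i. - 1 / d i) w \<le> qform n V (\<lambda>i. - 1 / e i) w"
    by (simp add: qform_def sum_negf)
qed

text \<open>Negation maps the negative half-line to the positive one and reverses the order, so the
  two matrices exchange roles.\<close>

lemma opmono_neg_inverse_neg: "opmono {..<0} (\<lambda>t. - 1 / t)"
  unfolding opmono_def
proof (intro allI impI ballI, goal_cases)
  case (1 n U V d e w)
  have "\<forall>w\<in>carrier_vec n. qform n V (\<lambda>i. - e i) w \<le> qform n U (\<lambda>i. - d i) w"
    using 1(5) by (simp add: qform_def sum_negf)
  then have "qform n V (\<lambda>i. - 1 / - e i) w \<le> qform n U (\<lambda>i. - 1 / - d i) w"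
    using 1 opmono_neg_inverse[unfolded opmono_def, rule_format, of n V U "\<lambda>i. - e i" "\<lambda>i. - d i" w]
    by (auto simp: image_subset_iff)
  then show ?case by (simp add: qform_def sum_negf)
qed

section \<open>Strict monotonicity and absence of jumps\<close>

lemma opmono_mono:
  assumes "opmono S F" "x \<in> S" "y \<in> S" "x \<le> y"
  shows "F x \<le> F y"
proof (cases "x = y")
  case False
  then have "x < y" using assms by simp
  moreover have "0 \<le> divdiff (\<lambda>t. (poly 1 t)\<^sup>2 * F t) {x, y}"
    using assms False by (intro opmono_divdiff_even[where m = 1]) auto
  moreover have "F x / (x - y) = - (F x / (y - x))"
    by (metis minus_diff_eq divide_minus_right)
  ultimately have "0 \<le> (F y - F x) / (y - x)"
    by (simp add: divdiff_def insert_Diff_if diff_divide_distrib)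
  then show ?thesis using \<open>x < y\<close> by (simp add: zero_le_divide_iff)
qed simp

text \<open>The square \<open>(t - u)^2\<close> over the nodes \<open>u, x, y, z\<close> loses one
  factor to the node \<open>u\<close>. What remains is a second-order condition on
  \<open>(t - u) F(t)\<close> with a free parameter \<open>u\<close>, in which \<open>F u\<close>
  does not occur.\<close>

lemma opmono_three_points:
  assumes F: "opmono S F" and S: "x \<in> S" "y \<in> S" "z \<in> S" "u \<in> S"
    and ne: "distinct [x, y, z, u]"
  shows "0 \<le> (x - u) * F x / ((x - y) * (x - z)) + (y - u) * F y / ((y - x) * (y - z))
    + (z - u) * F z / ((z - x) * (z - y))"
proof -
  have "0 \<le> divdiff (\<lambda>t. (poly [:- u, 1:] t)\<^sup>2 * F t) {u, x, y, z}"
    using assms by (intro opmono_divdiff_even[where m = 2]) auto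
  also have "\<dots> = divdiff (\<lambda>t. (t - u) * ((t - u) * F t)) {u, x, y, z}"
    by (rule divdiff_cong) (simp add: power2_eq_square algebra_simps)
  also have "\<dots> = divdiff (\<lambda>t. (t - u) * F t) {x, y, z}"
    using ne by (subst divdiff_mult_diff) auto
  also have "\<dots> = (x - u) * F x / ((x - y) * (x - z)) + (y - u) * F y / ((y - x) * (y - z))
    + (z - u) * F z / ((z - x) * (z - y))"
    using ne by (simp add: divdiff_def insert_Diff_if)
  finally show ?thesis .
qed

text \<open>If \<open>F x = F y\<close>, concavity keeps \<open>F\<close> from rising to the right
  of \<open>y\<close>, and convexity of \<open>t (F t - F x)\<close>, the three-point inequality
  with \<open>u = 0\<close>, keeps it from being smaller to the left of \<open>x\<close>. Continuity
  carries the constancy to 0.\<close>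

lemma opmono_strict_mono:
  assumes F: "opmono {0..} F" "continuous_on {0..} F" and nc: "\<not> F constant_on {0..}"
    and xy: "0 \<le> x" "x < y"
  shows "F x < F y"
proof (rule ccontr)
  assume "\<not> F x < F y"
  then have eq: "F x = F y" using opmono_mono[OF F(1), of x y] xy by simp
  define G where "G t = F t + (- F x)" for t
  have G: "opmono {0..} G" unfolding G_def by (intro opmono_add F opmono_const)
  have G0: "G x = 0" "G y = 0" using eq by (simp_all add: G_def)
  have Gm: "G s \<le> G t" if "0 \<le> s" "s \<le> t" for s t using opmono_mono[OF G] that by simp
  have right: "G t = 0" if t: "y < t" for t
  proof -
    have "divdiff (\<lambda>t. (poly 1 t)\<^sup>2 * G t) {x, y, t} \<le> 0"
      using xy t by (intro opmono_divdiff_odd[OF G, where m = 1]) auto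
    then have "G t / ((t - x) * (t - y)) \<le> 0"
      using xy t by (simp add: divdiff_def insert_Diff_if G0)
    moreover have "0 < (t - x) * (t - y)" using xy t by simp
    ultimately have "G t \<le> 0" by (simp add: divide_le_0_iff)
    then show ?thesis using Gm[of y t] G0 xy t by simp
  qed
  have left: "G t = 0" if t: "0 < t" "t < x" for t
  proof -
    have "0 \<le> (t - 0) * G t / ((t - x) * (t - y)) + (x - 0) * G x / ((x - t) * (x - y))
      + (y - 0) * G y / ((y - t) * (y - x))"
      using xy t by (intro opmono_three_points[OF G]) auto
    then have "0 \<le> t * G t / ((t - x) * (t - y))" by (simp add: G0)
    moreover have "0 < (t - x) * (t - y)" using xy t by (intro mult_neg_neg) auto
    ultimately have "0 \<le> G t" using t by (simp add: zero_le_divide_iff zero_le_mult_iff)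
    then show ?thesis using Gm[of t x] G0 t by simp
  qed
  have pos: "G t = 0" if "0 < t" for t
    using left[OF that] right[of t] Gm[of x t] Gm[of t y] G0 xy that by fastforce
  have "((\<lambda>s. G (0 + s)) \<longlongrightarrow> G 0) (at_right 0)"
  proof -
    have "continuous_on {0..} G" unfolding G_def by (intro continuous_intros F)
    then have "(G \<longlongrightarrow> G 0) (at 0 within {0..})" by (simp add: continuous_on_def)
    then show ?thesis by (simp add: at_within_Ici_at_right)
  qed
  moreover have "((\<lambda>s. G (0 + s)) \<longlongrightarrow> 0) (at_right 0)"
    using pos by (intro tendsto_eventually eventually_mono[OF eventually_at_right_less[of 0]]) auto
  ultimately have "G 0 = 0" by (rule tendsto_unique[rotated]) simp
  with pos have "F t = F x" if "0 \<le> t" for t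
    using that by (cases "t = 0") (force simp: G_def)+
  then show False using nc by (auto simp: constant_on_def)
qed

lemma mono_tendsto_at_right:
  fixes g :: "real \<Rightarrow> real"
  assumes pq: "p < q" and mono: "\<And>x y. p < x \<Longrightarrow> x \<le> y \<Longrightarrow> y < q \<Longrightarrow> g x \<le> g y"
    and bd: "\<And>x. p < x \<Longrightarrow> x < q \<Longrightarrow> B \<le> g x"
  obtains L where "(g \<longlongrightarrow> L) (at_right p)" "B \<le> L"
proof -
  define L where "L = Inf (g ` {p<..<q})"
  have bb: "bdd_below (g ` {p<..<q})" using bd by (auto intro!: bdd_belowI[of _ B])
  have ne: "g ` {p<..<q} \<noteq> {}" using pq by simp
  have "(g \<longlongrightarrow> L) (at_right p)"
  proof (rule order_tendstoI)
    fix l assume "l < L"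
    then have "l < g x" if "p < x" "x < q" for x
      using cInf_lower[OF _ bb, of "g x"] that by (auto simp: L_def)
    then show "\<forall>\<^sub>F x in at_right p. l < g x"
      using pq by (intro eventually_at_rightI[of p q]) auto
  next
    fix u assume "L < u"
    then obtain x where x: "p < x" "x < q" "g x < u"
      using cInf_lessD[OF ne, of u] unfolding L_def by auto
    show "\<forall>\<^sub>F x in at_right p. g x < u"
    proof (rule eventually_at_rightI[of p x])
      fix y assume "y \<in> {p<..<x}"
      then have "g y \<le> g x" using mono[of y x] x by simp
      then show "g y < u" using x by simp
    qed (use x in simp)
  qed
  moreover have "B \<le> L" unfolding L_def using bd ne by (intro cInf_greatest) auto
  ultimately show ?thesis using that by blast
qed

lemma mono_tendsto_at_left:
  fixes g :: "real \<Rightarrow> real"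
  assumes pq: "q < p" and mono: "\<And>x y. q < x \<Longrightarrow> x \<le> y \<Longrightarrow> y < p \<Longrightarrow> g x \<le> g y"
    and bd: "\<And>x. q < x \<Longrightarrow> x < p \<Longrightarrow> g x \<le> B"
  obtains L where "(g \<longlongrightarrow> L) (at_left p)" "L \<le> B"
proof -
  obtain L where L: "((\<lambda>x. - g (- x)) \<longlongrightarrow> L) (at_right (- p))" "- B \<le> L"
  proof (rule mono_tendsto_at_right[of "- p" "- q" "\<lambda>x. - g (- x)" "- B"])
    show "- p < - q" using pq by simp
    show "- g (- x) \<le> - g (- y)" if "- p < x" "x \<le> y" "y < - q" for x y
      using mono[of "- y" "- x"] that by simp
    show "- B \<le> - g (- x)" if "- p < x" "x < - q" for x
      using bd[of "- x"] that by simp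
  qed auto
  have "((\<lambda>x. - (- g (- x))) \<longlongrightarrow> - L) (at_right (- p))"
    by (intro tendsto_minus L)
  then show ?thesis using that[of "- L"] L(2) by (simp add: filterlim_at_left_to_right)
qed

text \<open>The inequality for four points \<open>p - 2s, p - s, p + s, p + 2s\<close> survives the limit \<open>s \<rightarrow> 0\<close>
  and rules out a jump.\<close>

lemma opmono_no_jump:
  assumes g: "opmono S g" and r: "0 < r" "{p - r<..<p + r} - {p} \<subseteq> S"
    and L: "(g \<longlongrightarrow> L) (at_left p)" and R: "(g \<longlongrightarrow> R) (at_right p)"
  shows "R \<le> L"
proof -
  \<comment> \<open>The coefficients are those of the three-point inequality with
    \<open>u = p + 2 * s\<close>, multiplied by \<open>s\<close>. In the limit
    \<open>- 4 / 3 + 3 / 2 = 1 / 6\<close> leaves \<open>(L - R) / 6 \<ge> 0\<close>; the value at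
    \<open>p\<close> does not occur.\<close>
  have ev: "\<forall>\<^sub>F s in at_right 0. 0 \<le> - 4 / 3 * g (p - 2 * s) + 3 / 2 * g (p - s) - 1 / 6 * g (p + s)"
  proof (rule eventually_at_rightI[of 0 "r / 2"])
    fix s assume s: "s \<in> {0<..<r / 2}"
    have "0 \<le> (p - 2 * s - (p + 2 * s)) * g (p - 2 * s) / ((p - 2 * s - (p - s)) * (p - 2 * s - (p + s)))
      + (p - s - (p + 2 * s)) * g (p - s) / ((p - s - (p - 2 * s)) * (p - s - (p + s)))
      + (p + s - (p + 2 * s)) * g (p + s) / ((p + s - (p - 2 * s)) * (p + s - (p - s)))"
      using s r(2) by (intro opmono_three_points[OF g]) auto
    also have "\<dots> = (- 4 / 3 * g (p - 2 * s) + 3 / 2 * g (p - s) - 1 / 6 * g (p + s)) / s"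
      using s by (simp add: field_simps)
    finally show "0 \<le> - 4 / 3 * g (p - 2 * s) + 3 / 2 * g (p - s) - 1 / 6 * g (p + s)"
      using s by (simp add: zero_le_divide_iff)
  qed (use r in simp)
  have lim: "((\<lambda>s. g (p + c * s)) \<longlongrightarrow> M) (at_right 0)"
    if "(g \<longlongrightarrow> M) F" "\<forall>\<^sub>F s in at_right 0. p + c * s \<in> A" "F = at p within A" "p \<notin> A" for c M F A
  proof (rule filterlim_compose[OF that(1)])
    have "((\<lambda>s. p + c * s) \<longlongrightarrow> p + c * 0) (at_right 0)" by (intro tendsto_intros)
    then show "filterlim (\<lambda>s. p + c * s) F (at_right 0)"
      using that(2,4) by (auto simp: that(3) filterlim_at elim!: eventually_mono)
  qed
  have pos: "\<forall>\<^sub>F s in at_right 0. (0::real) < s" by (rule eventually_at_right_less)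
  have "((\<lambda>s. g (p + (-2) * s)) \<longlongrightarrow> L) (at_right 0)"
    by (rule lim[OF L _ refl]) (use pos in \<open>auto elim: eventually_mono\<close>)
  moreover have "((\<lambda>s. g (p + (-1) * s)) \<longlongrightarrow> L) (at_right 0)"
    by (rule lim[OF L _ refl]) (use pos in \<open>auto elim: eventually_mono\<close>)
  moreover have "((\<lambda>s. g (p + 1 * s)) \<longlongrightarrow> R) (at_right 0)"
    by (rule lim[OF R _ refl]) (use pos in \<open>auto elim: eventually_mono\<close>)
  ultimately have "((\<lambda>s. - 4 / 3 * g (p - 2 * s) + 3 / 2 * g (p - s) - 1 / 6 * g (p + s)) \<longlongrightarrow>
     - 4 / 3 * L + 3 / 2 * L - 1 / 6 * R) (at_right 0)"
    by (intro tendsto_intros) simp_all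
  from tendsto_lowerbound[OF this ev] show ?thesis by simp
qed


section \<open>Difference quotients\<close>

lemma point_functional_minus:
  "point_functional S L \<Longrightarrow> point_functional S (\<lambda>F. - L F)"
  using point_functional_cmult[of S L "-1"] by simp

lemma point_functional_diff:
  "point_functional S L \<Longrightarrow> point_functional S L' \<Longrightarrow> point_functional S (\<lambda>F. L F - L' F)"
  using point_functional_add[of S L "\<lambda>F. - L' F"] point_functional_minus[of S L'] by simp

lemma point_functional_divide:
  "point_functional S L \<Longrightarrow> point_functional S (\<lambda>F. L F / k)"
  using point_functional_cmult[of S L "1 / k"] by simp

lemma opmono_neg_inverse_shift:
  assumes "S \<subseteq> {0<..}" "0 \<le> s" "0 \<le> k"
  shows "opmono S (\<lambda>t. - (k / (t + s)))"
proof -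
  have "opmono {0<..} (\<lambda>t. - 1 / (t + s))"
    using assms(2) by (intro opmono_shift[OF opmono_neg_inverse]) auto
  from opmono_cmult[OF opmono_subset[OF this assms(1)] assms(3)] show ?thesis
    by simp
qed

text \<open>On \<open>1 / (u + s)\<close> the difference quotient is
  \<open>- 1 / ((a + s) (t + s))\<close>, again a multiple of the kernel.\<close>

lemma opmono_divided_difference:
  assumes F: "opmono {0<..} F" "continuous_on {0<..} F" and a: "0 < a"
  shows "opmono ({0<..} - {a}) (\<lambda>t. - ((F t - F a) / (t - a)))"
proof -
  let ?T = "\<lambda>F t. - ((F t - F a) / (t - a))"
  show ?thesis
  proof (rule opmono_transform[OF F, where T = ?T])
    fix t assume "t \<in> {0<..} - {a}"
    then show "point_functional {0<..} (\<lambda>F. ?T F t)"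
      using a by (intro point_functional_minus point_functional_divide point_functional_diff
        point_functional_eval) auto
  next
    fix s :: real assume s: "0 < s"
    have "opmono ({0<..} - {a}) (\<lambda>t. - ((1 / (a + s)) / (t + s)))"
      using s a by (intro opmono_neg_inverse_shift) auto
    then show "opmono ({0<..} - {a}) (\<lambda>t. - ?T (\<lambda>u. 1 / (u + s)) t)"
    proof (rule opmono_cong)
      fix t assume t: "t \<in> {0<..} - {a}"
      define x y where "x = t + s" and "y = a + s"
      have ne: "x \<noteq> 0" "y \<noteq> 0" "x - y \<noteq> 0" and e: "t - a = x - y"
        using t s a by (auto simp: x_def y_def)
      have "1 / x - 1 / y = - ((1 / y) / x) * (x - y)" using ne by (simp add: divide_simps)
      then have "- ((1 / y) / x) = (1 / x - 1 / y) / (x - y)" using ne(3) by simp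
      then show "- ((1 / (a + s)) / (t + s)) = - ?T (\<lambda>u. 1 / (u + s)) t"
        unfolding e by (simp add: x_def y_def)
    qed
  qed simp
qed

definition divdiff2 :: "real \<Rightarrow> real \<Rightarrow> (real \<Rightarrow> real) \<Rightarrow> real \<Rightarrow> real" where
  "divdiff2 a b F t = F t / ((t - a) * (t - b)) + F a / ((a - t) * (a - b)) + F b / ((b - t) * (b - a))"

lemma divdiff2_eq_divdiff:
  "t \<noteq> a \<Longrightarrow> t \<noteq> b \<Longrightarrow> a \<noteq> b \<Longrightarrow> divdiff2 a b F t = divdiff F {t, a, b}"
  by (simp add: divdiff2_def divdiff_def insert_Diff_if)

lemma divdiff2_linear:
  assumes "t \<noteq> a" "t \<noteq> b" "a \<noteq> b"
  shows "divdiff2 a b (\<lambda>t. t + c) t = 0"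
proof -
  have "divdiff (poly [:c, 1:]) {t, a, b} = 0"
    using assms by (subst divdiff_poly) (auto simp: coeff_eq_0)
  moreover have "divdiff (\<lambda>t. t + c) {t, a, b} = divdiff (poly [:c, 1:]) {t, a, b}"
    by (rule divdiff_cong) simp
  ultimately show ?thesis using assms by (simp add: divdiff2_eq_divdiff)
qed

text \<open>On \<open>1 / (u + s)\<close> the result is
  \<open>1 / ((a + s) (b + s) (t + s))\<close>, a positive multiple of the kernel.\<close>

lemma opmono_divdiff2:
  assumes F: "opmono {0<..} F" "continuous_on {0<..} F" and ab: "0 < a" "0 < b" "a \<noteq> b"
  shows "opmono ({0<..} - {a, b}) (divdiff2 a b F)"
proof (rule opmono_transform[OF F, where T = "divdiff2 a b"])
  fix t assume t: "t \<in> {0<..} - {a, b}"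
  then show "point_functional {0<..} (\<lambda>F. divdiff2 a b F t)"
    unfolding divdiff2_def
    using ab by (intro point_functional_add point_functional_divide point_functional_eval) auto
  show "divdiff2 a b (\<lambda>_. 1) t = 0"
    using t ab divdiff_const[of "{t, a, b}" 1] by (simp add: divdiff2_eq_divdiff)
next
  fix s :: real assume s: "0 < s"
  have "opmono ({0<..} - {a, b}) (\<lambda>t. - ((1 / ((a + s) * (b + s))) / (t + s)))"
    using s ab by (intro opmono_neg_inverse_shift) auto
  then show "opmono ({0<..} - {a, b}) (\<lambda>t. - divdiff2 a b (\<lambda>u. 1 / (u + s)) t)"
  proof (rule opmono_cong)
    fix t assume t: "t \<in> {0<..} - {a, b}"
    define x y z where "x = t + s" and "y = a + s" and "z = b + s"
    have ne: "x \<noteq> 0" "y \<noteq> 0" "z \<noteq> 0" "x - y \<noteq> 0" "x - z \<noteq> 0" "y - z \<noteq> 0"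
      using t s ab by (auto simp: x_def y_def z_def)
    have eqs: "t - a = x - y" "t - b = x - z" "a - b = y - z" "a - t = - (x - y)" "b - t = - (x - z)" "b - a = - (y - z)"
      by (simp_all add: x_def y_def z_def)
    have "1 / x / ((x - y) * (x - z)) + 1 / y / (- (x - y) * (y - z)) + 1 / z / (- (x - z) * - (y - z))
      = 1 / (y * z) / x"
      using ne by (simp add: divide_simps) (simp add: algebra_simps)
    then show "- ((1 / ((a + s) * (b + s))) / (t + s)) = - divdiff2 a b (\<lambda>u. 1 / (u + s)) t"
      unfolding divdiff2_def eqs by (simp add: x_def y_def z_def)
  qed
qed

lemma tendsto_at_right_0_shift:
  fixes f :: "real \<Rightarrow> real"
  assumes "continuous_on {0..} f" "0 \<le> a" "0 \<le> k"
  shows "((\<lambda>s. f (a + k * s)) \<longlongrightarrow> f a) (at_right 0)"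
proof (rule continuous_on_tendsto_compose[OF assms(1)])
  have "((\<lambda>s. a + k * s) \<longlongrightarrow> a + k * 0) (at_right 0)" by (intro tendsto_intros)
  then show "((\<lambda>s. a + k * s) \<longlongrightarrow> a) (at_right 0)" by simp
  show "\<forall>\<^sub>F s in at_right 0. a + k * s \<in> {0..}"
    using eventually_at_right_less[of "0::real"] by (rule eventually_mono) (use assms in auto)
qed (use assms in auto)

lemma continuous_on_atLeast_0I:
  fixes f :: "real \<Rightarrow> real"
  assumes "\<And>x. 0 < x \<Longrightarrow> isCont f x" "(f \<longlongrightarrow> f 0) (at_right 0)"
  shows "continuous_on {0..} f"
  unfolding continuous_on_def
proof
  fix x :: real assume "x \<in> {0..}"
  then consider "x = 0" | "0 < x" by force
  then show "(f \<longlongrightarrow> f x) (at x within {0..})"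
  proof cases
    case 1
    then show ?thesis using assms(2) by (simp add: at_within_Ici_at_right)
  next
    case 2
    then have "at x within {0..} = at x" by (intro at_within_interior) simp
    then show ?thesis using assms(1)[OF 2] by (simp add: isCont_def)
  qed
qed

section \<open>The function t / f(t) and the main theorem\<close>

lemma opmono_pos:
  assumes "opmono {0..} f" "continuous_on {0..} f" "\<And>t. 0 \<le> t \<Longrightarrow> 0 \<le> f t"
    and "\<not> f constant_on {0..}" "0 < t"
  shows "0 < f t"
  using opmono_strict_mono[OF assms(1,2,4), of 0 t] assms(3)[of 0] assms(5) by simp

text \<open>\<open>- f(t) / t\<close> is the limit of negated difference quotients with base point
  tending to 0, plus \<open>f(0)\<close> times \<open>- 1 / t\<close>; here
  \<open>f(0) \<ge> 0\<close> enters. Its values are negative, so \<open>x \<mapsto> - 1 / x\<close>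
  applies and gives \<open>t / f(t)\<close>.\<close>

lemma opmono_sharp_pos:
  assumes f: "opmono {0..} f" "continuous_on {0..} f" and pos: "\<And>t. 0 < t \<Longrightarrow> 0 < f t"
    and f0: "0 \<le> f 0"
  shows "opmono {0<..} (sharp f)"
proof -
  have sub: "{0<..} \<subseteq> {0::real..}" by force
  note f' = opmono_subset[OF f(1) sub] continuous_on_subset[OF f(2) sub]
  have "opmono {0<..} (\<lambda>t. - ((f t - f 0) / (t - 0)))"
  proof (rule opmono_limit[where A = "at_right 0"])
    show "\<forall>\<^sub>F a in at_right 0. opmono ({0<..} - {a}) (\<lambda>t. - ((f t - f a) / (t - a)))"
      using eventually_at_right_less[of "0::real"]
      by (rule eventually_mono) (rule opmono_divided_difference[OF f'])
    fix t :: real assume t: "t \<in> {0<..}"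
    have "\<forall>\<^sub>F a in at_right 0. a \<noteq> t" by (rule eventually_neq_at_within)
    then show "\<forall>\<^sub>F a in at_right 0. t \<in> {0<..} - {a}"
      by (rule eventually_mono) (use t in auto)
    have "(f \<longlongrightarrow> f 0) (at_right 0)"
      using tendsto_at_right_0_shift[OF f(2), of 0 1] by simp
    then show "((\<lambda>a. - ((f t - f a) / (t - a))) \<longlongrightarrow> - ((f t - f 0) / (t - 0))) (at_right 0)"
      using t by (intro tendsto_intros) auto
  qed simp
  from opmono_add[OF this opmono_cmult[OF opmono_neg_inverse f0]]
  have "opmono {0<..} (\<lambda>t. - (f t / t))"
    by (rule opmono_cong) (simp add: diff_divide_distrib)
  then have "opmono {0<..} (\<lambda>t. - 1 / - (f t / t))"
    by (rule opmono_compose[OF _ opmono_neg_inverse_neg]) (use pos in auto)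
  then show ?thesis by (rule opmono_cong) (simp add: sharp_def)
qed

text \<open>If \<open>f 0 = 0\<close>, the limit defining \<open>sharp f 0\<close> exists because
  \<open>t / f(t)\<close> is nondecreasing and bounded below by 0 on the positive axis.\<close>

lemma continuous_on_sharp:
  assumes f: "continuous_on {0..} f" and pos: "\<And>t. 0 < t \<Longrightarrow> 0 < f t"
    and sh: "opmono {0<..} (sharp f)"
  shows "continuous_on {0..} (sharp f)"
proof (rule continuous_on_atLeast_0I)
  fix x :: real assume x: "0 < x"
  have "isCont f x" using f x continuous_on_interior[of "{0..}" f x] by simp
  then have "isCont (\<lambda>t. t / f t) x" using pos[OF x] by (intro continuous_intros) auto
  moreover have "\<forall>\<^sub>F t in nhds x. t \<in> {0<..}" using x by (intro eventually_nhds_in_open) auto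
  then have "\<forall>\<^sub>F t in nhds x. t / f t = sharp f t"
    by (rule eventually_mono) (auto simp: sharp_def)
  ultimately show "isCont (sharp f) x" using isCont_cong[of "\<lambda>t. t / f t" "sharp f" x] by blast
next
  have ev: "\<forall>\<^sub>F t in at_right 0. t / f t = sharp f t"
    using eventually_at_right_less[of "0::real"] by (rule eventually_mono) (simp add: sharp_def)
  show "(sharp f \<longlongrightarrow> sharp f 0) (at_right 0)"
  proof (cases "f 0 = 0")
    case True
    obtain L where L: "(sharp f \<longlongrightarrow> L) (at_right 0)"
    proof (rule mono_tendsto_at_right[of 0 1 "sharp f" 0])
      show "sharp f x \<le> sharp f y" if "0 < x" "x \<le> y" for x y
        using opmono_mono[OF sh, of x y] that by simp
      show "0 \<le> sharp f x" if "0 < x" for x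
        using pos[OF that] that by (simp add: sharp_def)
    qed auto
    moreover from L have "((\<lambda>t. t / f t) \<longlongrightarrow> L) (at_right 0)"
      by (rule Lim_transform_eventually) (use ev in \<open>simp add: eq_commute\<close>)
    then have "sharp f 0 = L"
      using True tendsto_Lim[of "at_right 0" "\<lambda>t. t / f t" L] by (simp add: sharp_def at_within_Ici_at_right)
    ultimately show ?thesis by simp
  next
    case False
    have "(f \<longlongrightarrow> f 0) (at_right 0)"
      using tendsto_at_right_0_shift[OF f, of 0 1] by simp
    then have "((\<lambda>t. t / f t) \<longlongrightarrow> 0 / f 0) (at_right 0)"
      using False by (intro tendsto_intros) auto
    then have "(sharp f \<longlongrightarrow> 0 / f 0) (at_right 0)"
      by (rule Lim_transform_eventually[OF _ ev])
    then show ?thesis using False by (simp add: sharp_def)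
  qed
qed

text \<open>For \<open>f g = id\<close> the function below equals \<open>- (f - f a) (g - g b) / ((t - a) (t - b))\<close>; it is
  \<open>g(b) f[t,a,b] + f(a) g[t,a,b]\<close>, because its numerator vanishes at \<open>a\<close> and \<open>b\<close>. Points \<open>a\<close>, \<open>b\<close> that
  coincide or are zero are reached by a limit.\<close>

lemma opmono_pair:
  assumes f: "opmono {0..} f" "continuous_on {0..} f" "\<And>t. 0 \<le> t \<Longrightarrow> 0 \<le> f t"
    and g: "opmono {0..} g" "continuous_on {0..} g" "\<And>t. 0 \<le> t \<Longrightarrow> 0 \<le> g t"
    and fg: "\<And>t. 0 < t \<Longrightarrow> f t * g t = t" and ab: "0 \<le> a" "0 \<le> b"
  shows "opmono ({0<..} - {a, b}) (\<lambda>t. (g b * f t + f a * g t - t - f a * g b) / ((t - a) * (t - b)))"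
proof -
  have sub: "{0<..} \<subseteq> {0::real..}" by force
  note f' = opmono_subset[OF f(1) sub] continuous_on_subset[OF f(2) sub]
  note g' = opmono_subset[OF g(1) sub] continuous_on_subset[OF g(2) sub]
  define H where "H a b t = (g b * f t + f a * g t - t - f a * g b) / ((t - a) * (t - b))" for a b t
  have ne: "opmono ({0<..} - {p, q}) (H p q)" if pq: "0 < p" "0 < q" "p \<noteq> q" for p q
  proof -
    have "opmono ({0<..} - {p, q}) (\<lambda>t. g q * divdiff2 p q f t + f p * divdiff2 p q g t)"
      using pq f(3) g(3) by (intro opmono_add opmono_cmult opmono_divdiff2 f' g') auto
    then show ?thesis
    proof (rule opmono_cong)
      fix t assume t: "t \<in> {0<..} - {p, q}"
      have "g q * divdiff2 p q f t + f p * divdiff2 p q g t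
          = (g q * f t + f p * g t) / ((t - p) * (t - q)) + (g q * f p + f p * g p) / ((p - t) * (p - q))
            + (g q * f q + f p * g q) / ((q - t) * (q - p))"
        by (simp add: divdiff2_def distrib_left add_divide_distrib)
      \<comment> \<open>\<open>f p * g p = p\<close> and \<open>f q * g q = q\<close> turn the
        constant terms into values of an affine function, whose second divided difference is
        0.\<close>
      also have "\<dots> = (g q * f t + f p * g t) / ((t - p) * (t - q)) + (p + f p * g q) / ((p - t) * (p - q))
            + (q + f p * g q) / ((q - t) * (q - p))"
        using fg pq by (simp add: ac_simps)
      also have "\<dots> = H p q t + divdiff2 p q (\<lambda>t. t + f p * g q) t"
        by (simp add: H_def divdiff2_def diff_divide_distrib add_divide_distrib)
      also have "\<dots> = H p q t" using t pq divdiff2_linear[of t p q] by simp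
      finally show "g q * divdiff2 p q f t + f p * divdiff2 p q g t = H p q t" .
    qed
  qed
  have "opmono ({0<..} - {a, b}) (H a b)"
  proof (rule opmono_limit[where A = "at_right 0"])
    \<comment> \<open>The different speeds 1 and 2 separate the two points even if
      \<open>a = b\<close>: they meet only for \<open>s = a - b\<close>.\<close>
    have "\<forall>\<^sub>F s in at_right 0. s \<noteq> a - b" by (rule eventually_neq_at_within)
    then show "\<forall>\<^sub>F s in at_right 0. opmono ({0<..} - {a + 1 * s, b + 2 * s}) (H (a + 1 * s) (b + 2 * s))"
      using eventually_at_right_less[of "0::real"]
      by eventually_elim (rule ne, use ab in auto)
    fix t :: real assume t: "t \<in> {0<..} - {a, b}"
    have "\<forall>\<^sub>F s in at_right 0. s \<noteq> t - a" "\<forall>\<^sub>F s in at_right 0. s \<noteq> (t - b) / 2"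
      by (rule eventually_neq_at_within)+
    then show "\<forall>\<^sub>F s in at_right 0. t \<in> {0<..} - {a + 1 * s, b + 2 * s}"
      by eventually_elim (use t in auto)
    have lim: "((\<lambda>s. a + 1 * s) \<longlongrightarrow> a + 1 * 0) (at_right 0)" "((\<lambda>s. b + 2 * s) \<longlongrightarrow> b + 2 * 0) (at_right 0)"
      by (intro tendsto_intros)+
    show "((\<lambda>s. H (a + 1 * s) (b + 2 * s) t) \<longlongrightarrow> H a b t) (at_right 0)"
      unfolding H_def using t lim
      by (intro tendsto_intros tendsto_at_right_0_shift[OF f(2)] tendsto_at_right_0_shift[OF g(2)] ab) auto
  qed simp
  then show ?thesis by (simp add: H_def[abs_def])
qed

text \<open>One-sided limits exist by scalar monotonicity and the lower bound 0; at positive points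
  \<open>opmono_no_jump\<close> makes them equal. At 0 only the right-hand limit counts.\<close>

lemma opmono_tendsto_at:
  assumes h: "opmono ({0<..} - E) h" and E: "finite E" and p: "0 \<le> p"
    and nn: "\<And>t. t \<in> {0<..} - E \<Longrightarrow> 0 \<le> h t"
  shows "\<exists>L. (h \<longlongrightarrow> L) (at p within {0..})"
proof -
  obtain r where r: "0 < r" "\<And>t. t \<in> E \<Longrightarrow> t \<noteq> p \<Longrightarrow> r \<le> \<bar>t - p\<bar>"
    using finite_set_avoid[OF E, of p] by (auto simp: dist_real_def abs_minus_commute)
  have mono: "h x \<le> h y" if "x \<in> {0<..} - E" "y \<in> {0<..} - E" "x \<le> y" for x y
    using opmono_mono[OF h that] .
  have mem: "x \<in> {0<..} - E" if "0 < x" "x \<noteq> p" "\<bar>x - p\<bar> < r" for x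
    using r(2)[of x] that by auto
  obtain R where R: "(h \<longlongrightarrow> R) (at_right p)"
  proof (rule mono_tendsto_at_right[of p "p + r" h 0])
    show "h x \<le> h y" if "p < x" "x \<le> y" "y < p + r" for x y
      using that p by (intro mono mem) auto
    show "0 \<le> h x" if "p < x" "x < p + r" for x
      using that p by (intro nn mem) auto
  qed (use r in auto)
  show ?thesis
  proof (cases "p = 0")
    case True
    then show ?thesis using R by (auto simp: at_within_Ici_at_right)
  next
    case False
    \<comment> \<open>Within distance \<open>u\<close> of \<open>p\<close>, all points other than
      \<open>p\<close> are positive and outside \<open>E\<close>.\<close>
    define u where "u = min r p"
    have u: "0 < u" "u \<le> r" "u \<le> p" using r p False by (auto simp: u_def)
    define z where "z = p + u / 2"
    obtain L where L: "(h \<longlongrightarrow> L) (at_left p)" "L \<le> R"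
    proof (rule mono_tendsto_at_left[of "p - u" p h R])
      show "h x \<le> h y" if "p - u < x" "x \<le> y" "y < p" for x y
        using that u by (intro mono mem) auto
      show "h x \<le> R" if x: "p - u < x" "x < p" for x
      proof (rule tendsto_lowerbound[OF R])
        have "h x \<le> h y" if "p < y" "y < p + u" for y
          using that x u by (intro mono mem) auto
        then show "\<forall>\<^sub>F y in at_right p. h x \<le> h y"
          using u by (intro eventually_at_rightI[of p "p + u"]) auto
      qed simp
    qed (use u in auto)
    have "{p - u<..<p + u} - {p} \<subseteq> {0<..} - E"
    proof
      fix x assume "x \<in> {p - u<..<p + u} - {p}"
      then show "x \<in> {0<..} - E" using u by (intro mem) auto
    qed
    then have "R \<le> L" by (rule opmono_no_jump[OF h u(1) _ L(1) R])
    with L R have "(h \<longlongrightarrow> R) (at p)" by (simp add: filterlim_at_split)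
    moreover have "at p within {0..} = at p"
      using False p by (intro at_within_interior) auto
    ultimately show ?thesis by auto
  qed
qed

theorem theorem1:
  fixes f :: "real \<Rightarrow> real" and a b :: real
  assumes "0 \<le> a" and "0 \<le> b"
    and "operator_monotone_on {0..} f"
    and "\<And>t. 0 \<le> t \<Longrightarrow> 0 \<le> f t"
    and "\<not> f constant_on {0..}"
    and "\<not> sharp f constant_on {0..}"
  shows "operator_monotone_on {0..} (h_fun f a b)"
proof -
  define g where "g = sharp f"
  define E where "E = {a, b}"
  define q where "q = h_quotient f a b"
  have f: "opmono {0..} f" "continuous_on {0..} f"
    using assms(3) by (simp_all add: operator_monotone_on_iff_opmono)
  have pos: "0 < f t" if "0 < t" for t using opmono_pos[OF f assms(4,5) that] .
  have g0: "opmono {0<..} g"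
    unfolding g_def using assms(4) by (intro opmono_sharp_pos f pos) auto
  have gc: "continuous_on {0..} g"
    unfolding g_def by (rule continuous_on_sharp[OF f(2) pos g0[unfolded g_def]])
  have g: "opmono {0..} g" using opmono_extend[OF gc, of "{}"] g0 by simp
  have fg: "f t * g t = t" if "0 < t" for t using pos[OF that] that by (simp add: g_def sharp_def)
  have gpos: "0 < g t" if "0 < t" for t
    using pos[OF that] that by (simp add: g_def sharp_def)
  have gnn: "0 \<le> g t" if "0 \<le> t" for t
  proof (cases "t = 0")
    case True
    have "(g \<longlongrightarrow> g 0) (at_right 0)" using tendsto_at_right_0_shift[OF gc, of 0 1] by simp
    moreover have "\<forall>\<^sub>F t in at_right 0. 0 \<le> g t"
      using eventually_at_right_less[of "0::real"] by (rule eventually_mono) (simp add: gpos less_imp_le)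
    ultimately show ?thesis using True tendsto_lowerbound[of g "g 0" "at_right 0" 0] by simp
  qed (use gpos[of t] that in simp)
  have smf: "f x < f y" if "0 \<le> x" "x < y" for x y
    by (rule opmono_strict_mono[OF f assms(5) that])
  have smg: "g x < g y" if "0 \<le> x" "x < y" for x y
    by (rule opmono_strict_mono[OF g gc _ that]) (use assms(6) in \<open>simp add: g_def\<close>)
  \<comment> \<open>Strict monotonicity, which rests on \<open>f\<close> and \<open>sharp f\<close>
    not being constant, makes both difference quotients positive.\<close>
  have quot: "0 < (t - c) / (F t - F c)"
    if "0 \<le> t" "0 \<le> c" "t \<noteq> c" "\<And>x y. 0 \<le> x \<Longrightarrow> x < y \<Longrightarrow> F x < F y" for t c and F :: "real \<Rightarrow> real"
    using that(4)[of t c] that(4)[of c t] that(1-3) by (cases "t < c") (auto simp: zero_less_divide_iff)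
  have qpos: "0 < q t" if "0 \<le> t" "t \<notin> E" for t
  proof -
    have "0 < (t - a) / (f t - f a) * ((t - b) / (g t - g b))"
      using that assms(1,2) by (intro mult_pos_pos quot smf smg) (auto simp: E_def)
    then show ?thesis by (simp add: q_def h_quotient_def g_def)
  qed
  have "opmono ({0<..} - E) (\<lambda>t. - 1 / q t)"
  proof (rule opmono_cong)
    show "opmono ({0<..} - E) (\<lambda>t. (g b * f t + f a * g t - t - f a * g b) / ((t - a) * (t - b)))"
      unfolding E_def by (rule opmono_pair[OF f assms(4) g gc gnn fg assms(1,2)])
    fix t assume t: "t \<in> {0<..} - E"
    have "g b * f t + f a * g t - t - f a * g b = - ((f t - f a) * (g t - g b))"
      using fg[of t] t by (simp add: algebra_simps)
    then show "(g b * f t + f a * g t - t - f a * g b) / ((t - a) * (t - b)) = - 1 / q t"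
      by (simp add: q_def h_quotient_def g_def)
  qed
  \<comment> \<open>\<open>- 1 / q\<close> is negative, so a second application of
    \<open>x \<mapsto> - 1 / x\<close> recovers \<open>q\<close> and preserves the order.\<close>
  then have "opmono ({0<..} - E) (\<lambda>t. - 1 / (- 1 / q t))"
    by (rule opmono_compose[OF _ opmono_neg_inverse_neg]) (use qpos in auto)
  then have q: "opmono ({0<..} - E) q"
    by (rule opmono_cong) simp
  have hq: "h_fun f a b t = q t" if "t \<notin> E" for t
    using that by (auto simp: h_fun_def q_def E_def)
  have ev: "\<forall>\<^sub>F s in at t within {0..}. q s = h_fun f a b s" for t
  proof -
    have "\<forall>\<^sub>F s in at t within {0..}. \<forall>x\<in>E. s \<noteq> x"
      by (intro eventually_ball_finite ballI eventually_neq_at_within) (simp add: E_def)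
    then show ?thesis by (rule eventually_mono) (auto simp: hq)
  qed
  have "continuous_on {0..} (h_fun f a b)"
    unfolding continuous_on_def
  proof
    fix t :: real assume "t \<in> {0..}"
    then have t: "0 \<le> t" by simp
    have "(q \<longlongrightarrow> h_fun f a b t) (at t within {0..})"
    proof (cases "t \<in> E")
      case True
      have "\<exists>L. (q \<longlongrightarrow> L) (at t within {0..})"
      proof (rule opmono_tendsto_at[OF q _ t])
        show "finite E" by (simp add: E_def)
        show "0 \<le> q s" if "s \<in> {0<..} - E" for s
          using qpos[of s] that by simp
      qed
      then obtain L where L: "(q \<longlongrightarrow> L) (at t within {0..})" by blast
      \<comment> \<open>\<open>Lim\<close> returns the limit only over a nontrivial filter:
        one-sided at 0, two-sided elsewhere.\<close>
      have "at t within {0..} \<noteq> bot"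
      proof (cases "t = 0")
        case True
        then show ?thesis by (simp add: at_within_Ici_at_right)
      next
        case False
        then have "at t within {0..} = at t" using t by (intro at_within_interior) simp
        then show ?thesis by simp
      qed
      then have "Lim (at t within {0..}) q = L" by (rule tendsto_Lim[OF _ L])
      then have "h_fun f a b t = L" using True by (simp add: h_fun_def q_def E_def)
      then show ?thesis using L by simp
    next
      case False
      have ft: "(f \<longlongrightarrow> f t) (at t within {0..})" and gt: "(g \<longlongrightarrow> g t) (at t within {0..})"
        using f(2) gc t by (simp_all add: continuous_on_def)
      have "f t - f a \<noteq> 0" "g t - g b \<noteq> 0"
        using False smf[of t a] smf[of a t] smg[of t b] smg[of b t] t assms(1,2) by (fastforce simp: E_def)+
      then have "((\<lambda>t. ((t - a) * (t - b)) / ((f t - f a) * (g t - g b))) \<longlongrightarrow>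
         ((t - a) * (t - b)) / ((f t - f a) * (g t - g b))) (at t within {0..})"
        by (intro tendsto_intros ft gt) auto
      then show ?thesis using hq[OF False] by (simp add: q_def g_def h_quotient_def[abs_def])
    qed
    then show "(h_fun f a b \<longlongrightarrow> h_fun f a b t) (at t within {0..})"
      by (rule Lim_transform_eventually[OF _ ev])
  qed
  moreover have "opmono ({0<..} - E) (h_fun f a b)"
    by (rule opmono_cong[OF q]) (simp add: hq)
  \<comment> \<open>The points \<open>a\<close>, \<open>b\<close> and 0 are now filled in by
    continuity.\<close>
  ultimately show ?thesis
    unfolding operator_monotone_on_iff_opmono
    using opmono_extend[of "h_fun f a b" E] by (simp add: E_def)
qed

end
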